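(* For every integer $n\ge 1$ with $n\notin\{1,2,3,4,8,9\}$, $$\pi_{\mathrm{opt}}(S_{6,n})=n.$$ Moreover $\pi_{\mathrm{opt}}(S_{6,3})=\pi_{\mathrm{opt}}(S_{6,4})=5$, $\pi_{\mathrm{opt}}(S_{6,8})=9$ and $\pi_{\mathrm{opt}}(S_{6,9})=10$.
   Context: A pebbling distribution $P$ on a finite simple graph $G$ is a function $P:V(G)\to\mathbb{Z}_{\ge 0}$; its size is $|P|=\sum_{v}P(v)$. A pebbling move from a vertex $u$ having at least two pebbles to a neighbor $v$ of $u$ removes two pebbles from $u$ and adds one pebble to $v$. A vertex $v$ is reachable under $P$ if some (possibly empty) sequence of pebbling moves starting from $P$ yields a distribution with at least one pebble on $v$. $P$ is solvable if every vertex of $G$ is reachable under $P$. The optimal pebbling number $\pi_{\mathrm{opt}}(G)$ is the minimum size of a solvable distribution on $G$. Let $SG$ be the infinite square grid: vertex set $\mathbb{Z}^2$, with $(i,j)$ and $(i',j')$ adjacent iff $|i-i'|+|j-j'|=1$. For $k\in\mathbb{Z}$ let $D^+_k=\{(i,j): i-j=k\}$ (positive diagonal) and $D^-_k=\{(i,j): i+j=k\}$ (negative diagonal). For integers $n\ge 1$ and even $m$, $S_{m,n}$ is the subgraph of $SG$ induced by $\left(\bigcup_{j=1}^m D^-_j\right)\cap\left(\bigcup_{i=1}^n D^+_i\right)$. *)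

theory Defs
  imports "Graph_Theory.Graph_Theory"
begin

text \<open>
  A finite simple graph is a \<open>graph\<close> in the sense of \<open>Graph_Theory\<close>: a finite symmetric loop-free
  digraph without parallel arcs, each edge being represented by its two opposite arcs.
\<close>

text \<open>
  A function on the vertex set is represented by a function on the whole type that is 0 outside the
  vertex set.
\<close>

definition pebbling_distribution :: "('a, 'b) pre_digraph \<Rightarrow> ('a \<Rightarrow> nat) \<Rightarrow> bool" where
  "pebbling_distribution G P \<longleftrightarrow> (\<forall>v. v \<notin> verts G \<longrightarrow> P v = 0)"

definition pebbling_size :: "('a, 'b) pre_digraph \<Rightarrow> ('a \<Rightarrow> nat) \<Rightarrow> nat" where
  "pebbling_size G P = (\<Sum>v\<in>verts G. P v)"

text \<open>The update below is the intended one because adjacent vertices of a loop-free graph are distinct.\<close>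

definition pebbling_move :: "('a, 'b) pre_digraph \<Rightarrow> ('a \<Rightarrow> nat) \<Rightarrow> ('a \<Rightarrow> nat) \<Rightarrow> bool" where
  "pebbling_move G P Q \<longleftrightarrow>
     (\<exists>u v. u \<rightarrow>\<^bsub>G\<^esub> v \<and> P u \<ge> 2 \<and> Q = P(u := P u - 2, v := P v + 1))"

definition pebbling_reachable :: "('a, 'b) pre_digraph \<Rightarrow> ('a \<Rightarrow> nat) \<Rightarrow> 'a \<Rightarrow> bool" where
  "pebbling_reachable G P v \<longleftrightarrow> (\<exists>Q. (pebbling_move G)\<^sup>*\<^sup>* P Q \<and> Q v \<ge> 1)"

definition pebbling_solvable :: "('a, 'b) pre_digraph \<Rightarrow> ('a \<Rightarrow> nat) \<Rightarrow> bool" where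
  "pebbling_solvable G P \<longleftrightarrow> (\<forall>v\<in>verts G. pebbling_reachable G P v)"

definition optimal_pebbling_number :: "('a, 'b) pre_digraph \<Rightarrow> nat" where
  "optimal_pebbling_number G =
     (LEAST k. \<exists>P. pebbling_distribution G P \<and> pebbling_solvable G P \<and> pebbling_size G P = k)"

definition square_grid :: "(int \<times> int, (int \<times> int) \<times> (int \<times> int)) pre_digraph" where
  "square_grid = with_proj
     \<lparr> pverts = UNIV, parcs = {((i, j), (i', j')). \<bar>i - i'\<bar> + \<bar>j - j'\<bar> = 1} \<rparr>"

definition pos_diagonal :: "int \<Rightarrow> (int \<times> int) set" where
  "pos_diagonal k = {(i, j). i - j = k}"

definition neg_diagonal :: "int \<Rightarrow> (int \<times> int) set" where
  "neg_diagonal k = {(i, j). i + j = k}"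

definition diagonal_grid ::
  "nat \<Rightarrow> nat \<Rightarrow> (int \<times> int, (int \<times> int) \<times> (int \<times> int)) pre_digraph" where
  "diagonal_grid m n = square_grid \<restriction>
     ((\<Union>j\<in>{1..int m}. neg_diagonal j) \<inter> (\<Union>i\<in>{1..int n}. pos_diagonal i))"

lemma graph_diagonal_grid: "graph (diagonal_grid m n)"
proof -
  let ?U = "(\<Union>j\<in>{1..int m}. neg_diagonal j) \<inter> (\<Union>i\<in>{1..int n}. pos_diagonal i)"
  have "?U \<subseteq> {- int n..int m + int n} \<times> {- int n..int m + int n}"
    by (auto simp: pos_diagonal_def neg_diagonal_def)
  then have fin: "finite ?U"
    by (rule finite_subset) simp
  have verts: "verts (diagonal_grid m n) = ?U"
    by (simp add: diagonal_grid_def)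
  have arcs: "arcs (diagonal_grid m n) =
      {((i, j), (i', j')). \<bar>i - i'\<bar> + \<bar>j - j'\<bar> = 1 \<and> (i, j) \<in> ?U \<and> (i', j') \<in> ?U}"
    by (auto simp: diagonal_grid_def square_grid_def)
  have ends: "tail (diagonal_grid m n) = fst" "head (diagonal_grid m n) = snd"
    by (simp_all add: diagonal_grid_def square_grid_def)
  have fin_arcs: "finite (arcs (diagonal_grid m n))"
    by (rule finite_subset[OF _ finite_cartesian_product[OF fin fin]]) (auto simp: arcs)
  show ?thesis
  proof
    show "finite (verts (diagonal_grid m n))" using fin verts by simp
    show "finite (arcs (diagonal_grid m n))" by (rule fin_arcs)
    show "symmetric (diagonal_grid m n)"
      unfolding symmetric_def
      by (rule symI) (auto simp: arcs_ends_conv ends arcs abs_minus_commute)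
  qed (auto simp: arcs verts ends arc_to_ends_def)
qed

lemma ex_pebbling_solvable:
  "\<exists>P. pebbling_distribution G P \<and> pebbling_solvable G P"
proof (intro exI conjI)
  let ?P = "\<lambda>v. if v \<in> verts G then 1 else 0 :: nat"
  show "pebbling_distribution G ?P"
    by (simp add: pebbling_distribution_def)
  have "(pebbling_move G)\<^sup>*\<^sup>* ?P ?P"
    by simp
  then show "pebbling_solvable G ?P"
    unfolding pebbling_solvable_def pebbling_reachable_def
    by (intro ballI exI[of _ ?P]) simp
qed

end

theory Submission
  imports Defs Complex_Main
begin

text \<open>
  In the coordinates \<open>d = i - j\<close>, \<open>s = i + j\<close> the graph has \<open>n\<close> columns of three vertices and every move
  changes both \<open>d\<close> and \<open>s\<close> by one. Collapsing columns gives a distribution \<open>q\<close> on the path with \<open>n\<close> vertices.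
  Let \<open>L i = q i + \<lfloor>L (i - 1) / 2\<rfloor>\<close> be the number of pebbles that the columns up to \<open>i\<close> can gather at \<open>i\<close>,
  and let \<open>R\<close> be its mirror image. Then
  \<open>2 * (\<Sum>i. q i) = L n + R 1 + (\<Sum>i<n. \<lceil>L i / 2\<rceil> + \<lceil>R (i + 1) / 2\<rceil>)\<close>,
  and a summand is at least 2 if both columns next to the cut can receive two pebbles.

  A column that can receive only one pebble is empty and fed from one side, and the cut on its other side
  is never crossed. There the distribution splits, so induction leaves the case that only
  the columns 1 and \<open>n\<close> are of this kind. Reaching both the corner and the far vertex of such a column,
  and the corner of the column before it, constrains the last three columns enough to make up for the
  deficit in the above sum; for \<open>n \<ge> 8\<close> this yields one additional pebble.
  For \<open>n \<le> 3\<close> one collapses rows instead of columns.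

  Conversely, blocks of 5, 6 and 7 columns admit solvable distributions with 5, 6 and 7 pebbles.
\<close>

section \<open>Moves and flows\<close>

text \<open>The exceptional lengths come from rounding. Suppose \<open>n \<ge> 5\<close> and no cut
  splits the distribution. If both end columns can receive two pebbles, the doubled size is at least
  \<open>2 * n + 2\<close>. One deficient end leaves \<open>2 * n + 1\<close>, and parity restores
  the missing unit. Two deficient ends leave \<open>2 * n - 1\<close>, hence only \<open>n\<close>
  pebbles, until for \<open>n \<ge> 8\<close> the gains at the two ends lie on disjoint cuts and
  give \<open>2 * n + 1\<close> again. So size \<open>n\<close> requires pieces of 5, 6 or 7
  columns, and 8 and 9 are the numbers above 4 that are not sums of these. For the lower bound a
  sequence of moves is replaced by the number of moves along each arc: the order is forgotten, and
  the remaining linear inequalities between integers may be summed over columns or rows. Column sums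
  alone are too weak because they ignore in which row two pebbles have to meet; hence the finer
  system for the last three columns.\<close>

definition gmove :: "('a \<Rightarrow> 'a \<Rightarrow> bool) \<Rightarrow> ('a \<Rightarrow> nat) \<Rightarrow> ('a \<Rightarrow> nat) \<Rightarrow> bool" where
  "gmove A P Q \<longleftrightarrow> (\<exists>u v. A u v \<and> 2 \<le> P u \<and> Q = P(u := P u - 2, v := P v + 1))"

definition reach :: "('a \<Rightarrow> 'a \<Rightarrow> bool) \<Rightarrow> ('a \<Rightarrow> nat) \<Rightarrow> 'a \<Rightarrow> bool" where
  "reach A P v \<longleftrightarrow> (\<exists>Q. (gmove A)\<^sup>*\<^sup>* P Q \<and> 1 \<le> Q v)"

text \<open>The distributions are compared on \<open>S\<close> only, so the lemma serves
  isomorphisms as well as embeddings of a piece into a larger strip.\<close>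

lemma reach_map:
  assumes inj: "inj_on h S"
    and A: "\<And>u v. A u v \<Longrightarrow> u \<in> S \<and> v \<in> S \<and> A' (h u) (h v)"
    and PP': "\<And>w. w \<in> S \<Longrightarrow> P' (h w) = P w"
    and v: "v \<in> S" and r: "reach A P v"
  shows "reach A' P' (h v)"
proof -
  from r obtain Q where Q: "(gmove A)\<^sup>*\<^sup>* P Q" "1 \<le> Q v"
    unfolding reach_def by blast
  from Q(1) have "\<exists>Q'. (gmove A')\<^sup>*\<^sup>* P' Q' \<and> (\<forall>w\<in>S. Q' (h w) = Q w)"
  proof (induction rule: rtranclp_induct)
    case base
    then show ?case using PP' by blast
  next
    case (step R Q)
    then obtain R' where R': "(gmove A')\<^sup>*\<^sup>* P' R'" "\<forall>w\<in>S. R' (h w) = R w"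
      by blast
    from step.hyps(2) obtain a b where ab: "A a b" "2 \<le> R a" "Q = R(a := R a - 2, b := R b + 1)"
      unfolding gmove_def by blast
    define Q' where "Q' = R'(h a := R' (h a) - 2, h b := R' (h b) + 1)"
    have S: "a \<in> S" "b \<in> S" "A' (h a) (h b)"
      using A ab(1) by blast+
    have "gmove A' R' Q'"
      unfolding gmove_def Q'_def using S R'(2) ab(2) by (intro exI[of _ "h a"] exI[of _ "h b"]) simp
    moreover have "\<forall>w\<in>S. Q' (h w) = Q w"
      using S R'(2) inj unfolding Q'_def ab(3) by (auto simp: inj_on_eq_iff)
    ultimately show ?case
      using R'(1) by (meson rtranclp.rtrancl_into_rtrancl)
  qed
  then show ?thesis
    using Q(2) v unfolding reach_def by auto
qed

text \<open>\<open>f u v\<close> counts the moves from \<open>u\<close> to \<open>v\<close>. The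
  balance may be taken over a \<open>W\<close> larger than the support of \<open>A\<close>, so moves
  inside one half can be measured in the whole strip.\<close>

lemma moves_flow:
  assumes "(gmove A)\<^sup>*\<^sup>* P Q" and fin: "finite W"
    and A: "\<And>u v. A u v \<Longrightarrow> u \<in> W \<and> v \<in> W \<and> u \<noteq> v"
  shows "\<exists>f :: 'a \<Rightarrow> 'a \<Rightarrow> nat. (\<forall>u v. f u v \<noteq> 0 \<longrightarrow> A u v) \<and>
    (\<forall>w. Q w + 2 * (\<Sum>v\<in>W. f w v) = P w + (\<Sum>u\<in>W. f u w))"
  using assms(1)
proof (induction rule: rtranclp_induct)
  case base
  then show ?case by (intro exI[of _ "\<lambda>_ _. 0"]) simp
next
  case (step R Q)
  then obtain f where f: "\<And>u v. f u v \<noteq> 0 \<Longrightarrow> A u v"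
    "\<And>w. R w + 2 * (\<Sum>v\<in>W. f w v) = P w + (\<Sum>u\<in>W. f u w)"
    by blast
  from step.hyps(2) obtain a b where ab: "A a b" "2 \<le> R a" "Q = R(a := R a - 2, b := R b + 1)"
    unfolding gmove_def by blast
  have S: "a \<in> W" "b \<in> W" "a \<noteq> b" using A ab(1) by blast+
  define f' where "f' u v = f u v + (if u = a \<and> v = b then 1 else 0)" for u v
  have out: "(\<Sum>v\<in>W. f' w v) = (\<Sum>v\<in>W. f w v) + (if w = a then 1 else 0)" for w
    using S fin by (cases "w = a") (simp_all add: f'_def sum.distrib)
  have "in": "(\<Sum>u\<in>W. f' u w) = (\<Sum>u\<in>W. f u w) + (if w = b then 1 else 0)" for w
    using S fin by (cases "w = b") (simp_all add: f'_def sum.distrib)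
  have "Q w + 2 * (\<Sum>v\<in>W. f' w v) = P w + (\<Sum>u\<in>W. f' u w)" for w
    using f(2)[of w] ab(2) S unfolding out "in" ab(3) by auto
  moreover have "f' u v \<noteq> 0 \<Longrightarrow> A u v" for u v
    using f(1) ab(1) unfolding f'_def by (auto split: if_splits)
  ultimately show ?case by blast
qed

section \<open>Level sums\<close>

definition level_sum :: "('a \<Rightarrow> int) \<Rightarrow> 'a set \<Rightarrow> ('a \<Rightarrow> nat) \<Rightarrow> int \<Rightarrow> nat" where
  "level_sum l W P i = (\<Sum>w\<in>{w\<in>W. l w = i}. P w)"

definition level_flow :: "('a \<Rightarrow> int) \<Rightarrow> 'a set \<Rightarrow> ('a \<Rightarrow> 'a \<Rightarrow> nat) \<Rightarrow> int \<Rightarrow> int \<Rightarrow> nat" where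
  "level_flow l W f i j = (\<Sum>u\<in>{w\<in>W. l w = i}. \<Sum>v\<in>{w\<in>W. l w = j}. f u v)"

lemma sum_neighbour_levels:
  fixes g :: "'a \<Rightarrow> nat"
  assumes fin: "finite W" and g: "\<And>w. g w \<noteq> 0 \<Longrightarrow> \<bar>l w - i\<bar> = (1::int)"
  shows "(\<Sum>w\<in>W. g w) = (\<Sum>w\<in>{w\<in>W. l w = i - 1}. g w) + (\<Sum>w\<in>{w\<in>W. l w = i + 1}. g w)"
proof -
  have "(\<Sum>w\<in>W. g w) = (\<Sum>w\<in>{w\<in>W. l w = i - 1} \<union> {w\<in>W. l w = i + 1}. g w)"
  proof (rule sum.mono_neutral_right)
    show "\<forall>w\<in>W - ({w\<in>W. l w = i - 1} \<union> {w\<in>W. l w = i + 1}). g w = 0"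
    proof
      fix w assume w: "w \<in> W - ({w\<in>W. l w = i - 1} \<union> {w\<in>W. l w = i + 1})"
      show "g w = 0"
      proof (rule ccontr)
        assume "g w \<noteq> 0"
        then have "\<bar>l w - i\<bar> = 1" by (rule g)
        with w show False by auto
      qed
    qed
  qed (use fin in auto)
  also have "\<dots> = (\<Sum>w\<in>{w\<in>W. l w = i - 1}. g w) + (\<Sum>w\<in>{w\<in>W. l w = i + 1}. g w)"
    by (rule sum.union_disjoint) (use fin in auto)
  finally show ?thesis .
qed

text \<open>Every arc joins consecutive levels, so the collapsed flow obeys the pebbling balance of
  a path. The level is left open: it is the column \<open>fst\<close> for long strips and the row
  \<open>snd\<close> for short ones.\<close>

lemma level_balance:
  assumes fin: "finite W" and f: "\<And>u v. f u v \<noteq> 0 \<Longrightarrow> \<bar>l u - l v\<bar> = 1"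
    and bal: "\<And>w. Q w + 2 * (\<Sum>v\<in>W. f w v) = P w + (\<Sum>u\<in>W. f u w)"
  shows "level_sum l W Q i + 2 * (level_flow l W f i (i + 1) + level_flow l W f i (i - 1)) =
    level_sum l W P i + level_flow l W f (i - 1) i + level_flow l W f (i + 1) i"
proof -
  let ?C = "\<lambda>i. {w\<in>W. l w = i}"
  have "level_sum l W Q i + 2 * (\<Sum>w\<in>?C i. \<Sum>v\<in>W. f w v) =
    (\<Sum>w\<in>?C i. Q w + 2 * (\<Sum>v\<in>W. f w v))"
    by (simp add: level_sum_def sum.distrib sum_distrib_left)
  also have "\<dots> = level_sum l W P i + (\<Sum>w\<in>?C i. \<Sum>u\<in>W. f u w)"
    unfolding bal by (simp add: level_sum_def sum.distrib)
  finally have 1: "level_sum l W Q i + 2 * (\<Sum>w\<in>?C i. \<Sum>v\<in>W. f w v) =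
    level_sum l W P i + (\<Sum>w\<in>?C i. \<Sum>u\<in>W. f u w)" .
  have "(\<Sum>w\<in>?C i. \<Sum>v\<in>W. f w v) =
    (\<Sum>w\<in>?C i. (\<Sum>v\<in>?C (i - 1). f w v) + (\<Sum>v\<in>?C (i + 1). f w v))"
    by (intro sum.cong refl sum_neighbour_levels[OF fin]) (use f in fastforce)
  then have 2: "(\<Sum>w\<in>?C i. \<Sum>v\<in>W. f w v) = level_flow l W f i (i - 1) + level_flow l W f i (i + 1)"
    by (simp add: level_flow_def sum.distrib)
  have swap: "level_flow l W f j i = (\<Sum>w\<in>?C i. \<Sum>u\<in>?C j. f u w)" for j
    unfolding level_flow_def by (rule sum.swap)
  have "(\<Sum>w\<in>?C i. \<Sum>u\<in>W. f u w) =
    (\<Sum>w\<in>?C i. (\<Sum>u\<in>?C (i - 1). f u w) + (\<Sum>u\<in>?C (i + 1). f u w))"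
    by (intro sum.cong refl sum_neighbour_levels[OF fin]) (use f in fastforce)
  then have 3: "(\<Sum>w\<in>?C i. \<Sum>u\<in>W. f u w) = level_flow l W f (i - 1) i + level_flow l W f (i + 1) i"
    by (simp add: swap sum.distrib)
  show ?thesis using 1 unfolding 2 3 by simp
qed

section \<open>Weighted prefix sums on a path\<close>

primrec prefix_load :: "(int \<Rightarrow> nat) \<Rightarrow> nat \<Rightarrow> nat" where
  "prefix_load q 0 = 0"
| "prefix_load q (Suc k) = q (int (Suc k)) + prefix_load q k div 2"

definition lload :: "(int \<Rightarrow> nat) \<Rightarrow> int \<Rightarrow> nat" where
  "lload q i = prefix_load q (nat i)"

text \<open>Defined by reflection, so that each fact about \<open>lload\<close> yields its mirror
  image.\<close>

definition rload :: "int \<Rightarrow> (int \<Rightarrow> nat) \<Rightarrow> int \<Rightarrow> nat" where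
  "rload n q i = lload (\<lambda>j. q (n + 1 - j)) (n + 1 - i)"

lemma lload_0 [simp]: "i \<le> 0 \<Longrightarrow> lload q i = 0"
  by (simp add: lload_def)

lemma lload_rec:
  assumes "\<And>i. i \<le> 0 \<Longrightarrow> q i = 0"
  shows "lload q i = q i + lload q (i - 1) div 2"
proof (cases "i \<le> 0")
  case False
  then have "nat i = Suc (nat (i - 1))" "int (Suc (nat (i - 1))) = i" by simp_all
  then show ?thesis unfolding lload_def by (metis prefix_load.simps(2))
qed (use assms in simp)

lemma rload_0 [simp]: "n < i \<Longrightarrow> rload n q i = 0"
  by (simp add: rload_def)

lemma rload_rec:
  assumes "\<And>i. n < i \<Longrightarrow> q i = 0"
  shows "rload n q i = q i + rload n q (i + 1) div 2"
  unfolding rload_def by (subst lload_rec) (simp_all add: assms algebra_simps)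

text \<open>\<open>x i\<close> and \<open>y i\<close> are the flows to the right and to the left
  across the cut between \<open>i\<close> and \<open>i + 1\<close>. By integrality the claim at
  \<open>i\<close> gives \<open>x i - 2 * y i \<le> lload q i div 2\<close>, and this is the net
  gain of column \<open>i + 1\<close> from that cut.\<close>

lemma lload_bound:
  fixes q q' x y :: "int \<Rightarrow> nat"
  assumes bal: "\<And>i. q' i + 2 * (x i + y (i - 1)) = q i + x (i - 1) + y i"
    and q0: "\<And>i. i \<le> 0 \<Longrightarrow> q i = 0" and x0: "\<And>i. i \<le> 0 \<Longrightarrow> x i = 0"
  shows "2 * x i \<le> lload q i + y i"
proof (cases "i \<le> 0")
  case False
  then have "0 \<le> i" by simp
  then show ?thesis
  proof (induction i rule: int_ge_induct)
    case (step i)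
    then show ?case
      using bal[of "i + 1"] lload_rec[of q "i + 1", OF q0] by simp
  qed (use x0 in simp)
qed (use x0 in simp)

lemma rload_bound:
  fixes q q' x y :: "int \<Rightarrow> nat"
  assumes bal: "\<And>i. q' i + 2 * (x i + y (i - 1)) = q i + x (i - 1) + y i"
    and q0: "\<And>i. n < i \<Longrightarrow> q i = 0" and y0: "\<And>i. n \<le> i \<Longrightarrow> y i = 0"
  shows "2 * y i \<le> rload n q (i + 1) + x i"
proof -
  \<comment> \<open>Reflection exchanges \<open>x\<close> and \<open>y\<close> and turns the cut
    \<open>i\<close> into the cut \<open>n - i\<close>.\<close>
  have "2 * y (n - (n - i)) \<le> lload (\<lambda>j. q (n + 1 - j)) (n - i) + x (n - (n - i))"
  proof (rule lload_bound[where q' = "\<lambda>j. q' (n + 1 - j)"])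
    fix j
    have eqs: "n - (j - 1) = n + 1 - j" "n + 1 - j - 1 = n - j" by simp_all
    show "q' (n + 1 - j) + 2 * (y (n - j) + x (n - (j - 1))) =
      q (n + 1 - j) + y (n - (j - 1)) + x (n - j)"
      using bal[of "n + 1 - j"] unfolding eqs by (simp only: ac_simps)
  qed (use q0 y0 in simp_all)
  then show ?thesis by (simp add: rload_def)
qed

text \<open>Telescoping: each column passes on half of its load rounded down, so the half rounded up
  is lost there.\<close>

lemma sum_eq_lload:
  assumes q0: "\<And>i. i \<le> 0 \<Longrightarrow> q i = 0"
  shows "(\<Sum>i\<in>{1..int n}. q i) = lload q (int n) + (\<Sum>i\<in>{1..int n - 1}. (lload q i + 1) div 2)"
proof (induction n)
  case (Suc n)
  have 1: "(\<Sum>i\<in>{1..int (Suc n)}. g i) = (\<Sum>i\<in>{1..int n}. g i) + g (int n + 1)" for g :: "int \<Rightarrow> nat"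
  proof -
    have "{1..int (Suc n)} = insert (int n + 1) {1..int n}" by auto
    then show ?thesis by simp
  qed
  have 2: "(\<Sum>i\<in>{1..int n}. (lload q i + 1) div 2) =
    (\<Sum>i\<in>{1..int n - 1}. (lload q i + 1) div 2) + (lload q (int n) + 1) div 2"
  proof (cases n)
    case (Suc k)
    then have "{1..int n} = insert (int n) {1..int n - 1}" by auto
    then show ?thesis by simp
  qed simp
  have "lload q (int n + 1) = q (int n + 1) + lload q (int n) div 2"
    using lload_rec[of q "int n + 1", OF q0] by simp
  then show ?case
    using Suc.IH 1[of q] 2 by (simp add: algebra_simps)
qed simp

text \<open>The identity for \<open>lload\<close> is added to its mirror image. Right loads are
  taken at \<open>i + 1\<close> so that both terms of a summand belong to the same cut.\<close>

lemma sum_eq_loads: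
  assumes "\<And>i. i \<le> 0 \<Longrightarrow> q i = 0" and "\<And>i. int n < i \<Longrightarrow> q i = 0"
  shows "2 * (\<Sum>i\<in>{1..int n}. q i) = lload q (int n) + rload (int n) q 1 +
    (\<Sum>i\<in>{1..int n - 1}. (lload q i + 1) div 2 + (rload (int n) q (i + 1) + 1) div 2)"
proof -
  have "(\<Sum>i\<in>{1..int n}. q i) = (\<Sum>i\<in>{1..int n}. q (int n + 1 - i))"
    by (rule sum.reindex_bij_witness[of _ "\<lambda>i. int n + 1 - i" "\<lambda>i. int n + 1 - i"]) auto
  also have "\<dots> = rload (int n) q 1 +
    (\<Sum>i\<in>{1..int n - 1}. (rload (int n) q (int n + 1 - i) + 1) div 2)"
    by (subst sum_eq_lload) (simp_all add: assms rload_def)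
  also have "(\<Sum>i\<in>{1..int n - 1}. (rload (int n) q (int n + 1 - i) + 1) div 2) =
    (\<Sum>i\<in>{1..int n - 1}. (rload (int n) q (i + 1) + 1) div 2)"
    by (rule sum.reindex_bij_witness[of _ "\<lambda>i. int n - i" "\<lambda>i. int n - i"]) (auto simp: algebra_simps)
  finally show ?thesis
    using sum_eq_lload[of q n] assms(1) by (simp add: sum.distrib)
qed

section \<open>Flows at the end of a strip\<close>

text \<open>
  Balance conditions of a flow in the last three columns \<open>a\<close>, \<open>b\<close>, \<open>d\<close> (from right to left): \<open>ba s t\<close> is the
  flow from row \<open>s\<close> of column \<open>b\<close> to row \<open>t\<close> of column \<open>a\<close>, and so on; \<open>i\<close> and \<open>out\<close> are the flows into and out
  of \<open>d\<close> through the remaining columns, whose load is \<open>L\<close>; \<open>B\<close> and \<open>D\<close> are the pebbles on \<open>b\<close> and \<open>d\<close>, while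
  \<open>a\<close> is empty. The target is marked by \<open>ta1\<close> (row 1 of \<open>a\<close>), \<open>ta3\<close> (row 5 of \<open>a\<close>) or \<open>tb3\<close> (row 6 of \<open>b\<close>).
\<close>

locale end_system =
  fixes ta1 ta3 tb3 :: nat and ba ab db bd :: "int \<Rightarrow> int \<Rightarrow> nat"
    and i out B D :: "int \<Rightarrow> nat" and L :: nat
  assumes a1: "ta1 + 2 * ab 1 2 \<le> ba 2 1"
    and a2: "2 * (ab 3 2 + ab 3 4) \<le> ba 2 3 + ba 4 3"
    and a3: "ta3 + 2 * (ab 5 4 + ab 5 6) \<le> ba 4 5 + ba 6 5"
    and b1: "2 * (ba 2 1 + ba 2 3 + bd 2 1 + bd 2 3) \<le> B 2 + ab 1 2 + ab 3 2 + db 1 2 + db 3 2"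
    and b2: "2 * (ba 4 3 + ba 4 5 + bd 4 3 + bd 4 5) \<le> B 4 + ab 3 4 + ab 5 4 + db 3 4 + db 5 4"
    and b3: "tb3 + 2 * (ba 6 5 + bd 6 5) \<le> B 6 + ab 5 6 + db 5 6"
    and d1: "2 * (db 1 2 + out 1) \<le> D 1 + bd 2 1 + i 1"
    and d2: "2 * (db 3 2 + db 3 4 + out 3) \<le> D 3 + bd 2 3 + bd 4 3 + i 3"
    and d3: "2 * (db 5 4 + db 5 6 + out 5) \<le> D 5 + bd 4 5 + bd 6 5 + i 5"
    and g: "2 * (i 1 + i 3 + i 5) \<le> L + out 1 + out 3 + out 5"
begin

definition "xc = ba 2 1 + ba 2 3 + ba 4 3 + ba 4 5 + ba 6 5"
definition "yc = ab 1 2 + ab 3 2 + ab 3 4 + ab 5 4 + ab 5 6"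
definition "xe = db 1 2 + db 3 2 + db 3 4 + db 5 4 + db 5 6"
definition "ye = bd 2 1 + bd 2 3 + bd 4 3 + bd 4 5 + bd 6 5"
definition "xg = i 1 + i 3 + i 5"
definition "yg = out 1 + out 3 + out 5"

abbreviation "qc \<equiv> B 2 + B 4 + B 6"
abbreviation "qe \<equiv> D 1 + D 3 + D 5"

lemmas flow_defs = xc_def yc_def xe_def ye_def xg_def yg_def

lemma col_n: "ta1 + ta3 + 2 * yc \<le> xc"
  using a1 a2 a3 unfolding flow_defs distrib_left by linarith

lemma col_c: "tb3 + 2 * xc + 2 * ye \<le> qc + xe + yc"
  using b1 b2 b3 unfolding flow_defs distrib_left by linarith

lemma col_e: "2 * xe + 2 * yg \<le> qe + xg + ye"
  using d1 d2 d3 unfolding flow_defs distrib_left by linarith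

lemma col_g: "2 * xg \<le> L + yg"
  using g unfolding flow_defs distrib_left by linarith

text \<open>Eliminating \<open>xg\<close> bounds \<open>4 * xe\<close>; as all other terms are even,
  \<open>L\<close> may be rounded down to \<open>2 * (L div 2)\<close>. The bound
  \<open>xc_le\<close> repeats this one column further right.\<close>

lemma xe_le: "2 * xe \<le> qe + L div 2 + ye"
proof -
  have "4 * xe \<le> 2 * qe + L + 2 * ye"
    using col_e col_g unfolding distrib_left by linarith
  then show ?thesis by presburger
qed

lemma xc_le: "2 * xc \<le> qc + (qe + L div 2) div 2 + yc"
proof -
  have "4 * xc \<le> 2 * qc + (qe + L div 2) + 2 * yc"
    using col_c xe_le unfolding distrib_left by linarith
  then show ?thesis by presburger
qed

section \<open>Placements forced when column \<open>a\<close> receives a single pebble\<close>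

text \<open>With load at most 3 on \<open>b\<close>, the inequalities
  \<open>1 + 2 * yc \<le> xc\<close> and \<open>2 * xc \<le> 3 + yc\<close> leave no room for a
  pebble that is sent back.\<close>

lemma target_a:
  assumes "ta1 + ta3 = 1" "qc + (qe + L div 2) div 2 \<le> 3"
  shows "yc = 0" "xc = 1"
  using assms col_n xc_le unfolding distrib_left by linarith+

lemma one_pebble_aux:
  assumes "ta1 + ta3 = 1" "qc = 1" "qe + L div 2 \<le> 3"
  shows "xe = 1" "ye = 0"
proof -
  have "(qe + L div 2) div 2 \<le> 1" using assms(3) by simp
  then have "yc = 0" "xc = 1"
    using target_a assms by simp_all
  then show "xe = 1" "ye = 0"
    using col_c xe_le assms unfolding distrib_left by linarith+
qed

text \<open>Two pebbles must meet in row 2 of \<open>b\<close>, and only one arrives from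
  \<open>d\<close>. For the target in row 5 of \<open>a\<close> they must meet in row 4 or 6, so one
  pebble on \<open>b\<close> cannot serve both targets.\<close>

lemma one_pebble_a1:
  assumes "ta1 = 1" "ta3 = 0" "qc = 1" "qe + L div 2 \<le> 3"
  shows "1 \<le> B 2"
proof -
  have "(qe + L div 2) div 2 \<le> 1" using assms(4) by simp
  then have "yc = 0" "xc = 1" "xe = 1" "ye = 0"
    using target_a one_pebble_aux assms by simp_all
  then show ?thesis
    using a1 b1 assms unfolding flow_defs distrib_left by linarith
qed

lemma one_pebble_a3:
  assumes "ta3 = 1" "ta1 = 0" "qc = 1" "qe + L div 2 \<le> 3"
  shows "1 \<le> B 4 + B 6"
proof -
  have "(qe + L div 2) div 2 \<le> 1" using assms(4) by simp
  then have "yc = 0" "xc = 1" "xe = 1" "ye = 0"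
    using target_a one_pebble_aux assms by simp_all
  then show ?thesis
    using a3 b2 b3 assms unfolding flow_defs distrib_left by linarith
qed

lemma two_unfed_aux:
  assumes "ta1 + ta3 = 1" "qc = 2" "qe + L div 2 \<le> 1"
  shows "xe = 0" "ye = 0"
proof -
  have "(qe + L div 2) div 2 \<le> 1" using assms(3) by simp
  then have "yc = 0" "xc = 1"
    using target_a assms by simp_all
  then show "xe = 0" "ye = 0"
    using col_c xe_le assms unfolding distrib_left by linarith+
qed

text \<open>Nothing arrives from \<open>d\<close>, so both pebbles of \<open>b\<close> already lie
  next to the target, which again cannot hold for both targets.\<close>

lemma two_unfed_a1:
  assumes "ta1 = 1" "ta3 = 0" "qc = 2" "qe + L div 2 \<le> 1"
  shows "2 \<le> B 2"
proof -
  have "(qe + L div 2) div 2 \<le> 1" using assms(4) by simp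
  then have "yc = 0" "xc = 1" "xe = 0" "ye = 0"
    using target_a two_unfed_aux assms by simp_all
  then show ?thesis
    using a1 b1 assms unfolding flow_defs distrib_left by linarith
qed

lemma two_unfed_a3:
  assumes "ta3 = 1" "ta1 = 0" "qc = 2" "qe + L div 2 \<le> 1"
  shows "2 \<le> B 4 + B 6"
proof -
  have "(qe + L div 2) div 2 \<le> 1" using assms(4) by simp
  then have "yc = 0" "xc = 1" "xe = 0" "ye = 0"
    using target_a two_unfed_aux assms by simp_all
  then show ?thesis
    using a3 b2 b3 assms unfolding flow_defs distrib_left by linarith
qed

lemma two_fed_aux:
  assumes "ta1 + ta3 = 1" "qc = 2" "qe + L div 2 = 2"
  shows "yc = 0" "xc = 1" "xe \<le> 1" "ye = 0"
proof -
  show "yc = 0" "xc = 1"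
    using target_a assms by simp_all
  then show "xe \<le> 1" "ye = 0"
    using col_c xe_le assms unfolding distrib_left by linarith+
qed

text \<open>The pebble that enters \<open>b\<close> uses up the whole supply of \<open>d\<close>.
  Since \<open>d\<close> is not empty, at most one pebble of that supply comes from further
  left.\<close>

lemma two_fed_g:
  assumes "qe + L div 2 = 2" "1 \<le> qe" "xe = 1" "ye = 0"
  shows "yg = 0" "qe + xg = 2"
proof -
  have "L \<le> 2 * (L div 2) + 1" by simp
  moreover have "L div 2 = 2 - qe" "qe = 1 \<or> qe = 2" using assms unfolding distrib_left by linarith+
  ultimately show "yg = 0" "qe + xg = 2"
    using col_e col_g assms by (auto simp del: div_le_dividend)
qed

lemma two_fed_a1:
  assumes "ta1 = 1" "ta3 = 0" "qc = 2" "qe + L div 2 = 2"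
  shows "1 \<le> B 2"
  using a1 b1 assms two_fed_aux unfolding flow_defs distrib_left by linarith

text \<open>The second pebble for row 2 of \<open>b\<close> is made from two pebbles in rows 1 and 3
  of \<open>d\<close>. That is the whole supply of \<open>d\<close>, so none is left for row
  5.\<close>

lemma two_fed_a1':
  assumes "ta1 = 1" "ta3 = 0" "qc = 2" "qe + L div 2 = 2" "1 \<le> qe" "B 2 = 1"
  shows "D 5 = 0"
proof -
  have r: "yc = 0" "xc = 1" "xe \<le> 1" "ye = 0"
    using two_fed_aux assms by simp_all
  then have e: "xe = 1" "db 1 2 + db 3 2 = 1"
    using a1 b1 assms unfolding flow_defs distrib_left by linarith+
  have "yg = 0" "qe + xg = 2"
    using two_fed_g[OF assms(4,5) e(1) r(4)] by simp_all
  then show ?thesis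
    using d1 d2 e r unfolding flow_defs distrib_left by linarith
qed

lemma two_fed_a3:
  assumes "ta1 = 0" "ta3 = 1" "qc = 2" "qe + L div 2 = 2"
  shows "1 \<le> B 4 + B 6"
  using a3 b2 b3 assms two_fed_aux unfolding flow_defs distrib_left by linarith

text \<open>Row 6 of \<open>b\<close> is adjacent only to row 5 of \<open>d\<close>, which is empty
  and obtains at most one pebble from the left.\<close>

lemma two_fed_a3':
  assumes "ta1 = 0" "ta3 = 1" "qc = 2" "qe + L div 2 = 2" "1 \<le> qe" "D 5 = 0" "B 4 = 0" "B 6 = 1"
  shows False
proof -
  have r: "yc = 0" "xc = 1" "xe \<le> 1" "ye = 0"
    using two_fed_aux assms by simp_all
  have "ba 4 5 = 0"
    using b2 assms r unfolding flow_defs distrib_left by linarith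
  then have "db 5 6 = 1" "xe = 1"
    using a3 b3 assms r unfolding flow_defs distrib_left by linarith+
  moreover have "yg = 0" "qe + xg = 2"
    using two_fed_g[OF assms(4,5)] \<open>xe = 1\<close> r by simp_all
  ultimately show False
    using d3 assms r unfolding flow_defs distrib_left by linarith
qed

lemma two_fed_b3:
  assumes "ta1 = 0" "ta3 = 0" "tb3 = 1" "B 2 = 1" "B 4 = 1" "B 6 = 0" "qe + L div 2 = 2" "1 \<le> qe" "D 5 = 0"
  shows False
proof -
  have yc: "yc = 0" "xc \<le> 1" "ye \<le> 1"
    using col_n col_c xe_le assms unfolding distrib_left by linarith+
  then have "1 \<le> db 5 6" "xe \<le> 1"
    using b3 xe_le assms unfolding flow_defs distrib_left by linarith+
  then have e: "db 5 6 = 1" "xe = 1" "db 1 2 + db 3 2 + db 3 4 + db 5 4 = 0"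
    unfolding flow_defs distrib_left by linarith+
  \<comment> \<open>Each row of \<open>b\<close> has at most one pebble to spare, so nothing flows
    back to \<open>d\<close>.\<close>
  have "2 * (bd 2 1 + bd 2 3) \<le> 1" "2 * (bd 4 3 + bd 4 5) \<le> 1" "2 * bd 6 5 \<le> 0"
    using b1 b2 b3 yc e assms unfolding flow_defs distrib_left by linarith+
  then have "bd 2 1 + bd 2 3 = 0" "bd 4 3 + bd 4 5 = 0" "bd 6 5 = 0"
    by presburger+
  then have "ye = 0"
    unfolding ye_def by simp
  moreover have "yg = 0" "qe + xg = 2"
    using two_fed_g[OF assms(7,8) e(2) \<open>ye = 0\<close>] by simp_all
  ultimately show False
    using d3 e assms unfolding flow_defs distrib_left by linarith
qed

text \<open>As \<open>b\<close> is empty, both pebbles that it forwards to \<open>a\<close> come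
  from \<open>d\<close> and use up all four pebbles available there.\<close>

lemma none_fed_aux:
  assumes "ta1 + ta3 = 1" "qc = 0" "qe + L div 2 = 4" "L \<le> 2"
  shows "yc = 0" "xc = 1" "xe = 2" "ye = 0" "yg = 0" "qe + xg = 4"
proof -
  show "yc = 0" "xc = 1"
    using target_a assms by simp_all
  then show "xe = 2" "ye = 0"
    using col_c xe_le assms unfolding distrib_left by linarith+
  moreover have "L \<le> 1 \<and> qe = 4 \<or> L = 2 \<and> qe = 3"
    using assms(3,4) by (cases "L = 2") auto
  ultimately show "yg = 0" "qe + xg = 4"
    using col_e col_g unfolding distrib_left by linarith+
qed

lemma none_fed_a1:
  assumes "ta1 = 1" "ta3 = 0" "qc = 0" "qe + L div 2 = 4" "L \<le> 2"
  shows "D 5 = 0"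
proof -
  have r: "yc = 0" "xc = 1" "xe = 2" "ye = 0" "yg = 0" "qe + xg = 4"
    using none_fed_aux assms by simp_all
  then have "db 1 2 + db 3 2 = 2"
    using a1 b1 assms unfolding flow_defs distrib_left by linarith
  then show ?thesis
    using d1 d2 r unfolding flow_defs distrib_left by linarith
qed

text \<open>Row 5 of \<open>d\<close> must collect two pebbles for row 6 of \<open>b\<close>. It is
  empty, and \<open>L \<le> 2\<close> does not let two pebbles arrive from the left, even if others
  are sent back.\<close>

lemma none_fed_b3:
  assumes "ta1 = 0" "ta3 = 0" "tb3 = 1" "qc = 0" "qe + L div 2 = 4" "L \<le> 2" "D 5 = 0"
  shows False
proof -
  have r: "xc = 0" "yc = 0" "ye = 0" "1 \<le> xe"
    using col_n col_c xe_le assms unfolding distrib_left by linarith+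
  then have "1 \<le> db 5 6"
    using b3 assms unfolding flow_defs distrib_left by linarith
  then have "2 \<le> xg"
    using d3 r assms unfolding flow_defs distrib_left by linarith
  moreover have "L \<le> 1 \<and> qe = 4 \<or> L = 2 \<and> qe = 3"
    using assms(5,6) by (cases "L = 2") auto
  ultimately show False
    using col_e col_g r unfolding distrib_left by linarith
qed

end

section \<open>Loads and the weight of cuts\<close>

definition path_reach :: "int \<Rightarrow> (int \<Rightarrow> nat) \<Rightarrow> int \<Rightarrow> nat" where
  "path_reach n q i = q i + lload q (i - 1) div 2 + rload n q (i + 1) div 2"

definition cut_weight :: "int \<Rightarrow> (int \<Rightarrow> nat) \<Rightarrow> int \<Rightarrow> nat" where
  "cut_weight n q i = (lload q i + 1) div 2 + (rload n q (i + 1) + 1) div 2"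

text \<open>
  What solvability of the strip forces at a last column that receives a single pebble. The column sums alone
  would also allow, for instance, \<open>0, 0, 4, 0, 0\<close>.
\<close>

definition right_rules :: "int \<Rightarrow> (int \<Rightarrow> nat) \<Rightarrow> bool" where
  "right_rules n q \<longleftrightarrow> q n = 0 \<and> lload q (n - 1) div 2 = 1 \<and>
     (q (n - 1) = 1 \<longrightarrow> lload q (n - 1) = 3) \<and>
     (q (n - 1) = 2 \<longrightarrow> lload q (n - 1) = 3) \<and>
     (q (n - 1) = 2 \<and> lload q (n - 2) = 2 \<longrightarrow> q (n - 2) = 0) \<and>
     (q (n - 1) = 0 \<and> lload q (n - 2) = 4 \<longrightarrow> 3 \<le> lload q (n - 3))"

text \<open>Compares the load \<open>m\<close> of a column with the cut before it, where
  \<open>l\<close> counts from the left and the pebbles \<open>q\<close> of the column count from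
  the right.\<close>

lemma half_sum:
  fixes q l :: nat
  assumes "m = q + l div 2"
  shows "(m + 1) div 2 \<le> (l + 1) div 2 + (q + 1) div 2"
proof -
  have "l div 2 \<le> (l + 1) div 2" by (simp add: div_le_mono)
  moreover have "(q + l div 2 + 1) div 2 \<le> (q + 1 + 2 * (l div 2)) div 2"
    by (intro div_le_mono) simp
  moreover have "(q + 1 + 2 * (l div 2)) div 2 = (q + 1) div 2 + l div 2" by simp
  ultimately show ?thesis
    unfolding assms by linarith
qed

lemma rload_reflect: "rload n (\<lambda>j. q (n + 1 - j)) i = lload q (n + 1 - i)"
  by (simp add: rload_def)

lemma lload_reflect: "lload (\<lambda>j. q (n + 1 - j)) i = rload n q (n + 1 - i)"
  by (simp add: rload_def)

lemma cut_weight_reflect: "cut_weight n (\<lambda>j. q (n + 1 - j)) i = cut_weight n q (n - i)"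
proof -
  have eq: "n + 1 - (i + 1) = n - i" "n + 1 - i = n - i + 1" by simp_all
  show ?thesis
    unfolding cut_weight_def rload_reflect lload_reflect eq by (simp only: add.commute)
qed

locale path_load =
  fixes n :: int and q :: "int \<Rightarrow> nat"
  assumes q_left: "i \<le> 0 \<Longrightarrow> q i = 0" and q_right: "n < i \<Longrightarrow> q i = 0"
begin

abbreviation "L \<equiv> lload q"
abbreviation "R \<equiv> rload n q"
abbreviation "w \<equiv> cut_weight n q"

lemma L_rec: "L i = q i + L (i - 1) div 2"
  by (rule lload_rec) (rule q_left)

lemma R_rec: "R i = q i + R (i + 1) div 2"
  by (rule rload_rec) (rule q_right)

lemma path_reach_L: "path_reach n q i = L i + R (i + 1) div 2"
  unfolding path_reach_def by (subst (2) L_rec) (rule refl)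

lemma path_reach_R: "path_reach n q i = R i + L (i - 1) div 2"
  unfolding path_reach_def by (subst (2) R_rec) (simp only: ac_simps)

text \<open>If one of the two loads is 0, the other must deliver two pebbles and so is at least 4;
  otherwise each load contributes at least 1.\<close>

lemma cut_weight_ge_2:
  assumes "2 \<le> path_reach n q i" "2 \<le> path_reach n q (i + 1)"
  shows "2 \<le> w i"
proof -
  have "2 \<le> (l + 1) div 2 + (r + 1) div 2" if "2 \<le> l + r div 2" "2 \<le> r + l div 2" for l r :: nat
  proof -
    have mono: "k div 2 \<le> (k + 1) div 2" for k :: nat
      by (simp add: div_le_mono)
    consider "l = 0" | "r = 0" | "1 \<le> l" "1 \<le> r" by linarith
    then show ?thesis
    proof cases
      case 1
      then show ?thesis using that(1) mono[of r] by simp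
    next
      case 2
      then show ?thesis using that(2) mono[of l] by simp
    next
      case 3
      then have "1 \<le> (l + 1) div 2" "1 \<le> (r + 1) div 2" by simp_all
      then show ?thesis by linarith
    qed
  qed
  then show ?thesis
    using assms unfolding path_reach_L[of i] path_reach_R[of "i + 1"] cut_weight_def
    by (simp only: add_diff_cancel_right')
qed

context
  assumes rules: "right_rules n q"
begin

text \<open>The rules exclude load 2 with one or two pebbles on column \<open>n - 1\<close>. If that
  column is empty, load 2 comes from a load 4 or 5 before it.\<close>

lemma end_cases:
  obtains (full) "L (n - 1) = 3"
  | (five) "L (n - 1) = 2" "q (n - 1) = 0" "L (n - 2) = 5"
  | (four) "L (n - 1) = 2" "q (n - 1) = 0" "L (n - 2) = 4" "3 \<le> L (n - 3)"
proof -
  have c: "L (n - 1) = q (n - 1) + L (n - 2) div 2"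
    using L_rec[of "n - 1"] by simp
  have "L (n - 1) = 2 \<or> L (n - 1) = 3"
    using rules unfolding right_rules_def by presburger
  moreover have "q (n - 1) = 0 \<and> (L (n - 2) = 5 \<or> L (n - 2) = 4 \<and> 3 \<le> L (n - 3))" if "L (n - 1) = 2"
  proof -
    have "q (n - 1) \<noteq> 1" "q (n - 1) \<noteq> 2"
      using rules that unfolding right_rules_def by auto
    then have "q (n - 1) = 0"
      using c that by linarith
    moreover from this have "L (n - 2) = 4 \<or> L (n - 2) = 5"
      using c that by presburger
    ultimately show ?thesis
      using rules unfolding right_rules_def by blast
  qed
  ultimately show ?thesis
    using that by blast
qed

lemma R_end: "R n = 0" "R (n - 1) = q (n - 1)" "R (n - 2) = q (n - 2) + q (n - 1) div 2"
proof -
  show 1: "R n = 0"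
    using R_rec[of n] rules by (simp add: right_rules_def)
  show 2: "R (n - 1) = q (n - 1)"
    using R_rec[of "n - 1"] 1 by simp
  show "R (n - 2) = q (n - 2) + q (n - 1) div 2"
    using R_rec[of "n - 2"] 2 by simp
qed

lemma L_end: "L (n - 1) = q (n - 1) + L (n - 2) div 2" "L (n - 2) = q (n - 2) + L (n - 3) div 2"
  "L (n - 3) = q (n - 3) + L (n - 4) div 2"
  using L_rec[of "n - 1"] L_rec[of "n - 2"] L_rec[of "n - 3"] by simp_all

lemma w_end: "w (n - 1) = (L (n - 1) + 1) div 2" "w (n - 2) = (L (n - 2) + 1) div 2 + (q (n - 1) + 1) div 2"
  "w (n - 3) = (L (n - 3) + 1) div 2 + (R (n - 2) + 1) div 2"
  "w (n - 4) = (L (n - 4) + 1) div 2 + (R (n - 3) + 1) div 2"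
  using R_end by (simp_all add: cut_weight_def)

lemma five_cut: 
  assumes "L (n - 2) = 5" "q (n - 1) = 0"
  shows "3 \<le> w (n - 3)"
proof -
  have "5 = q (n - 2) + L (n - 3) div 2"
    using L_end assms by simp
  then have "3 \<le> (L (n - 3) + 1) div 2 + (q (n - 2) + 1) div 2"
    using half_sum[of 5 "q (n - 2)" "L (n - 3)"] by simp
  then show ?thesis
    using w_end R_end assms by simp
qed

lemma four_cut: 
  assumes "L (n - 2) = 4" "q (n - 1) = 0" "3 \<le> L (n - 3)"
  shows "3 \<le> w (n - 3)" "L (n - 3) \<noteq> 4 \<Longrightarrow> 4 \<le> w (n - 3)"
proof -
  have "4 = q (n - 2) + L (n - 3) div 2"
    using L_end assms by simp
  then have eq: "q (n - 2) = 4 - L (n - 3) div 2" "L (n - 3) div 2 \<le> 4" by simp_all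
  then have "L (n - 3) \<le> 9" by linarith
  \<comment> \<open>With \<open>L (n - 3) = 0\<close>, as in \<open>0, 0, 4, 0, 0\<close>, the cut
    would weigh only 2.\<close>
  then have "L (n - 3) \<in> {3, 4, 5, 6, 7, 8, 9}" using assms(3) by auto
  then have "3 \<le> (L (n - 3) + 1) div 2 + (q (n - 2) + 1) div 2"
    "L (n - 3) \<noteq> 4 \<Longrightarrow> 4 \<le> (L (n - 3) + 1) div 2 + (q (n - 2) + 1) div 2"
    unfolding eq(1) by auto
  then show "3 \<le> w (n - 3)" "L (n - 3) \<noteq> 4 \<Longrightarrow> 4 \<le> w (n - 3)"
    using w_end R_end assms by simp_all
qed

text \<open>Unless \<open>L (n - 1) = 3\<close>, the last cut weighs only 1, and one of the two cuts
  before it weighs at least 3.\<close>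

lemma last_cuts_3:
  assumes "2 \<le> w (n - 2)" "2 \<le> w (n - 3)"
  shows "6 \<le> w (n - 1) + w (n - 2) + w (n - 3)"
  using end_cases
proof cases
  case full
  then show ?thesis using assms w_end by simp
next
  case five
  then show ?thesis using assms w_end by simp
next
  case four
  then show ?thesis using assms w_end four_cut by simp
qed

text \<open>One more than four cuts of weight 2: the full case has a surplus of 1 at cut
  \<open>n - 2\<close> or \<open>n - 3\<close>, and in the other cases the three earlier cuts have a
  surplus of 2 against the deficit of 1 at the last.\<close>

lemma last_cuts_4:
  assumes "2 \<le> w (n - 2)" "2 \<le> w (n - 3)" "2 \<le> w (n - 4)" "2 \<le> path_reach n q (n - 2)"
  shows "9 \<le> w (n - 1) + w (n - 2) + w (n - 3) + w (n - 4)"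
  using end_cases
proof cases
  case full
  have "3 \<le> w (n - 2) \<or> 3 \<le> w (n - 3)"
  proof -
    have c: "3 = q (n - 1) + L (n - 2) div 2"
      using L_end full by simp
    then have "q (n - 1) \<le> 3" by simp
    then consider "q (n - 1) = 0" | "q (n - 1) = 1" | "q (n - 1) = 2" | "q (n - 1) = 3"
      by linarith
    then show ?thesis
    proof cases
      case 1
      then have "6 \<le> L (n - 2)" using c by presburger
      then have "6 div 2 \<le> (L (n - 2) + 1) div 2" by (intro div_le_mono) simp
      then show ?thesis using w_end(2) 1 by simp
    next
      case 2
      then have "4 \<le> L (n - 2)" using c by presburger
      then have "4 div 2 \<le> (L (n - 2) + 1) div 2" by (intro div_le_mono) simp
      then show ?thesis using w_end(2) 2 by simp
    next
      case 3
      then have "L (n - 2) = 2 \<or> L (n - 2) = 3" using c by presburger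
      then show ?thesis
      proof
        \<comment> \<open>Two pebbles on each of the columns \<open>n - 2\<close> and
          \<open>n - 1\<close> may leave both cuts with weight 2. The rule excludes this, so the
          load comes through the cut \<open>n - 3\<close>.\<close>
        assume e: "L (n - 2) = 2"
        then have "q (n - 2) = 0"
          using rules 3 by (simp add: right_rules_def)
        then have "4 \<le> L (n - 3)" "R (n - 2) = 1"
          using L_end(2) e R_end(3) 3 by auto
        moreover from this have "4 div 2 \<le> (L (n - 3) + 1) div 2" by (intro div_le_mono) simp
        ultimately show ?thesis using w_end(3) by simp
      qed (use w_end(2) 3 in simp)
    next
      case 4
      have "2 \<le> L (n - 2) + R (n - 1) div 2"
        using assms(4) L_end(2) by (simp add: path_reach_def)
      then have "1 \<le> L (n - 2)" using R_end(2) 4 by simp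
      then have "2 div 2 \<le> (L (n - 2) + 1) div 2" by (intro div_le_mono) simp
      then show ?thesis using w_end(2) 4 by simp
    qed
  qed
  then show ?thesis
    using assms w_end(1) full by auto
next
  case five
  then show ?thesis using assms w_end(1,2) five_cut by simp
next
  case four
  show ?thesis
  proof (cases "L (n - 3) = 4")
    case True
    \<comment> \<open>Here the cut \<open>n - 3\<close> has a surplus of only 1, but the two pebbles
      of column \<open>n - 2\<close> send one to the left, which makes the cut \<open>n - 4\<close>
      heavier.\<close>
    then have "q (n - 2) = 2"
      using L_end(2) four by simp
    then have "R (n - 3) = q (n - 3) + 1"
      using R_rec[of "n - 3"] R_end(3) four by simp
    moreover have "4 = q (n - 3) + L (n - 4) div 2"
      using L_end(3) True by simp
    then have "3 \<le> (L (n - 4) + 1) div 2 + (q (n - 3) + 1 + 1) div 2"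
      using half_sum[of 5 "q (n - 3) + 1" "L (n - 4)"] by simp
    ultimately have "3 \<le> w (n - 4)"
      using w_end(4) by simp
    then show ?thesis
      using assms w_end(1,2) four_cut(1) four by simp
  next
    case False
    then show ?thesis
      using assms w_end(1,2) four_cut(2) four by simp
  qed
qed

end

end

section \<open>Size of a distribution, by its deficient end columns\<close>

lemma sum_ge_2_card:
  fixes g :: "int \<Rightarrow> nat"
  assumes "\<And>i. a \<le> i \<Longrightarrow> i \<le> b \<Longrightarrow> 2 \<le> g i"
  shows "2 * nat (b + 1 - a) \<le> (\<Sum>i\<in>{a..b}. g i)"
proof -
  have "(\<Sum>i\<in>{a..b}. 2) \<le> (\<Sum>i\<in>{a..b}. g i)"
    by (rule sum_mono) (use assms in simp)
  then show ?thesis by simp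
qed

lemma sum_split_at:
  fixes g :: "int \<Rightarrow> nat"
  assumes "a \<le> b + 1" "b \<le> c"
  shows "(\<Sum>i\<in>{a..c}. g i) = (\<Sum>i\<in>{a..b}. g i) + (\<Sum>i\<in>{b+1..c}. g i)"
proof -
  have "{a..c} = {a..b} \<union> {b+1..c}" using assms by auto
  then show ?thesis by (simp add: sum.union_disjoint)
qed

lemma sum_last_3:
  fixes g :: "int \<Rightarrow> nat"
  shows "(\<Sum>i\<in>{n-3..n-1}. g i) = g (n - 1) + g (n - 2) + g (n - 3)"
proof -
  have "{n-3..n-1} = {n-1, n-2, n-3}" by auto
  then show ?thesis by simp
qed

lemma sum_last_4:
  fixes g :: "int \<Rightarrow> nat"
  shows "(\<Sum>i\<in>{n-4..n-1}. g i) = g (n - 1) + g (n - 2) + g (n - 3) + g (n - 4)"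
proof -
  have "{n-4..n-1} = {n-1, n-2, n-3, n-4}" by auto
  then show ?thesis by simp
qed

lemma sum_first_3:
  fixes g :: "int \<Rightarrow> nat"
  shows "(\<Sum>i\<in>{1..3}. g i) = g 1 + g 2 + g 3"
proof -
  have "{1..3} = {1, 2, 3::int}" by auto
  then show ?thesis by simp
qed

locale path_good = path_load +
  assumes good: "1 < i \<Longrightarrow> i < n \<Longrightarrow> 2 \<le> path_reach n q i"
begin

lemma inner_cut: "1 < i \<Longrightarrow> i < n - 1 \<Longrightarrow> 2 \<le> w i"
  by (rule cut_weight_ge_2) (use good in simp_all)

lemma total:
  assumes "1 \<le> n"
  shows "2 * (\<Sum>i\<in>{1..n}. q i) = L n + R 1 + (\<Sum>i\<in>{1..n-1}. w i)"
  using sum_eq_loads[of q "nat n"] q_left q_right assms by (simp add: cut_weight_def)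

text \<open>The doubled size is at least \<open>2 + 2 + 2 * (n - 1)\<close>.\<close>

lemma no_bad_end:
  assumes "1 \<le> n" "2 \<le> path_reach n q 1" "2 \<le> path_reach n q n"
  shows "nat n + 1 \<le> (\<Sum>i\<in>{1..n}. q i)"
proof -
  have "2 \<le> L n" "2 \<le> R 1"
    using assms L_rec[of n] R_rec[of 1] by (simp_all add: path_reach_def)
  moreover have "2 \<le> w i" if "1 \<le> i" "i \<le> n - 1" for i
    by (rule cut_weight_ge_2)
      (use assms good[of i] good[of "i + 1"] that in \<open>cases "i = 1"; cases "i + 1 = n"; simp add: add.commute\<close>)+
  then have "2 * nat n - 2 \<le> (\<Sum>i\<in>{1..n-1}. w i)"
    using sum_ge_2_card[of 1 "n - 1" w] by simp
  ultimately show ?thesis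
    using total[OF assms(1)] assms(1) by linarith
qed

lemma L_end_1: "right_rules n q \<Longrightarrow> L n = 1"
  using L_rec[of n] by (simp add: right_rules_def)

text \<open>The doubled size is at least \<open>2 + 1 + 6 + 2 * (n - 4) = 2 * n + 1\<close>, and it
  is even.\<close>

lemma one_bad_end:
  assumes "4 \<le> n" "2 \<le> path_reach n q 1" "right_rules n q"
  shows "nat n + 1 \<le> (\<Sum>i\<in>{1..n}. q i)"
proof -
  have w: "2 \<le> w i" if "1 \<le> i" "i < n - 1" for i
    by (rule cut_weight_ge_2)
      (use assms good[of i] good[of "i + 1"] that in \<open>cases "i = 1"; simp add: add.commute\<close>)+
  have "2 \<le> R 1"
    using assms R_rec[of 1] by (simp add: path_reach_def)
  moreover have "L n = 1"
    using assms(3) by (rule L_end_1)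
  moreover have "6 \<le> (\<Sum>i\<in>{n-3..n-1}. w i)"
    unfolding sum_last_3 by (rule last_cuts_3) (use assms w in simp_all)
  moreover have "2 * nat (n - 4) \<le> (\<Sum>i\<in>{1..n-4}. w i)"
    using sum_ge_2_card[of 1 "n - 4" w] w by simp
  moreover have "(\<Sum>i\<in>{1..n-1}. w i) = (\<Sum>i\<in>{1..n-4}. w i) + (\<Sum>i\<in>{n-3..n-1}. w i)"
    using sum_split_at[of 1 "n - 4" "n - 1" w] assms by (simp add: algebra_simps)
  ultimately show ?thesis
    using total assms(1) by linarith
qed

context
  assumes right: "right_rules n q" and left: "right_rules n (\<lambda>j. q (n + 1 - j))"
begin

lemma R_left: "q 1 = 0" "R 2 div 2 = 1" "q 2 = 1 \<Longrightarrow> R 2 = 3"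
  using left unfolding right_rules_def lload_reflect by simp_all

lemma R_left_1: "R 1 = 1"
  using R_rec[of 1] R_left by simp

text \<open>The doubled size is at least \<open>1 + 1 + 6 + 1 + 2 * (n - 5) = 2 * n - 1\<close>, and
  it is even.\<close>

lemma two_bad_ends:
  assumes "5 \<le> n"
  shows "nat n \<le> (\<Sum>i\<in>{1..n}. q i)"
proof -
  have "6 \<le> (\<Sum>i\<in>{n-3..n-1}. w i)"
    unfolding sum_last_3 by (rule last_cuts_3[OF right]) (use assms inner_cut in simp_all)
  moreover have "2 * nat (n - 5) \<le> (\<Sum>i\<in>{2..n-4}. w i)"
    using sum_ge_2_card[of 2 "n - 4" w] inner_cut by simp
  moreover have "(\<Sum>i\<in>{1..n-1}. w i) = (\<Sum>i\<in>{1..n-4}. w i) + (\<Sum>i\<in>{n-3..n-1}. w i)"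
    using sum_split_at[of 1 "n - 4" "n - 1" w] assms by (simp add: algebra_simps)
  moreover have "(\<Sum>i\<in>{1..n-4}. w i) = w 1 + (\<Sum>i\<in>{2..n-4}. w i)"
    using sum_split_at[of 1 1 "n - 4" w] assms by simp
  moreover have "1 \<le> w 1"
    using R_left by (simp add: cut_weight_def)
  ultimately show ?thesis
    using total L_end_1[OF right] R_left_1 assms by linarith
qed

text \<open>From \<open>n = 8\<close> on, the last four and the first three cuts are disjoint, so
  the doubled size is at least \<open>1 + 1 + 9 + 6 + 2 * (n - 8) = 2 * n + 1\<close>, and it is
  even.\<close>

lemma two_bad_ends_strict:
  assumes "8 \<le> n"
  shows "nat n + 1 \<le> (\<Sum>i\<in>{1..n}. q i)"
proof -
  interpret refl: path_load n "\<lambda>j. q (n + 1 - j)"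
    by unfold_locales (use q_left q_right in simp_all)
  have "9 \<le> (\<Sum>i\<in>{n-4..n-1}. w i)"
    unfolding sum_last_4 by (rule last_cuts_4[OF right]) (use assms inner_cut good in simp_all)
  moreover have "6 \<le> w 1 + w 2 + w 3"
    using refl.last_cuts_3[OF left] inner_cut assms by (simp add: cut_weight_reflect)
  then have "6 \<le> (\<Sum>i\<in>{1..3}. w i)"
    unfolding sum_first_3 .
  moreover have "2 * nat (n - 8) \<le> (\<Sum>i\<in>{4..n-5}. w i)"
    using sum_ge_2_card[of 4 "n - 5" w] inner_cut by simp
  moreover have "(\<Sum>i\<in>{1..n-1}. w i) = (\<Sum>i\<in>{1..n-5}. w i) + (\<Sum>i\<in>{n-4..n-1}. w i)"
    using sum_split_at[of 1 "n - 5" "n - 1" w] assms by (simp add: algebra_simps)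
  moreover have "(\<Sum>i\<in>{1..n-5}. w i) = (\<Sum>i\<in>{1..3}. w i) + (\<Sum>i\<in>{4..n-5}. w i)"
    using sum_split_at[of 1 3 "n - 5" w] assms by simp
  ultimately show ?thesis
    using total L_end_1[OF right] R_left_1 assms by linarith
qed

lemma two_bad_ends_4:
  assumes "n = 4"
  shows "5 \<le> (\<Sum>i\<in>{1..n}. q i)"
proof -
  have L: "L 1 = 0" "L 2 = q 2" "L 3 = q 3 + q 2 div 2"
    using L_rec[of 1] L_rec[of 2] L_rec[of 3] R_left by simp_all
  have R: "R 4 = 0" "R 3 = q 3" "R 2 = q 2 + q 3 div 2"
    using R_rec[of 4] R_rec[of 3] R_rec[of 2] right assms by (simp_all add: right_rules_def)
  have r: "(q 3 + q 2 div 2) div 2 = 1" "q 3 = 1 \<Longrightarrow> q 3 + q 2 div 2 = 3" "q 3 = 2 \<Longrightarrow> q 2 \<noteq> 2"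
    using right L assms by (auto simp: right_rules_def)
  have l: "(q 2 + q 3 div 2) div 2 = 1" "q 2 = 1 \<Longrightarrow> q 2 + q 3 div 2 = 3"
    using R_left R assms by simp_all
  have "5 \<le> q 2 + q 3"
  \<comment> \<open>Only columns 2 and 3 carry pebbles, so finitely many pairs remain.\<close>
  proof (rule ccontr)
    assume "\<not> ?thesis"
    then have "q 2 \<in> {0, 1, 2, 3, 4}" "q 3 \<in> {0, 1, 2, 3, 4}" "q 2 + q 3 \<le> 4" by auto
    then show False using r l by auto
  qed
  moreover have "{1..n} = {1, 2, 3, 4}" using assms by auto
  ultimately show ?thesis by simp
qed

end

end

context path_good
begin

lemma path_good_reflect: "path_good n (\<lambda>j. q (n + 1 - j))"
proof
  have eq: "path_reach n (\<lambda>j. q (n + 1 - j)) i = path_reach n q (n + 1 - i)" for i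
  proof -
    have "n + 1 - (i - 1) = n + 1 - i + 1" "n + 1 - (i + 1) = n + 1 - i - 1" by simp_all
    then show ?thesis
      unfolding path_reach_def lload_reflect rload_reflect by (simp only: ac_simps)
  qed
  show "2 \<le> path_reach n (\<lambda>j. q (n + 1 - j)) i" if "1 < i" "i < n" for i
    unfolding eq by (rule good) (use that in simp_all)
qed (use q_left q_right in simp_all)

lemma one_bad_end_left:
  assumes "4 \<le> n" "2 \<le> path_reach n q n" "right_rules n (\<lambda>j. q (n + 1 - j))"
  shows "nat n + 1 \<le> (\<Sum>i\<in>{1..n}. q i)"
proof -
  have "path_reach n (\<lambda>j. q (n + 1 - j)) 1 = path_reach n q n"
    unfolding path_reach_def lload_reflect rload_reflect by simp
  then have "nat n + 1 \<le> (\<Sum>i\<in>{1..n}. q (n + 1 - i))"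
    using path_good.one_bad_end[OF path_good_reflect assms(1) _ assms(3)] assms(2) by simp
  also have "\<dots> = (\<Sum>i\<in>{1..n}. q i)"
    by (rule sum.reindex_bij_witness[of _ "\<lambda>i. n + 1 - i" "\<lambda>i. n + 1 - i"]) auto
  finally show ?thesis .
qed

end

section \<open>Strips\<close>

text \<open>The grid itself is \<open>p = 0\<close>. The parity \<open>p\<close> closes the family
  under turning upside down, reflection and cutting off columns.\<close>

definition strip :: "int \<Rightarrow> int \<Rightarrow> (int \<times> int) set" where
  "strip p n = {(d, s). 1 \<le> d \<and> d \<le> n \<and> 1 \<le> s \<and> s \<le> 6 \<and> even (d + s + p)}"

definition diag_adj :: "(int \<times> int) set \<Rightarrow> int \<times> int \<Rightarrow> int \<times> int \<Rightarrow> bool" where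
  "diag_adj W u v \<longleftrightarrow> u \<in> W \<and> v \<in> W \<and> \<bar>fst u - fst v\<bar> = 1 \<and> \<bar>snd u - snd v\<bar> = 1"

definition solvable :: "(int \<times> int) set \<Rightarrow> (int \<times> int \<Rightarrow> nat) \<Rightarrow> bool" where
  "solvable W P \<longleftrightarrow> (\<forall>v\<in>W. reach (diag_adj W) P v)"

lemma finite_strip [simp]: "finite (strip p n)"
  by (rule finite_subset[of _ "{1..n} \<times> {1..6}"]) (auto simp: strip_def)

lemma strip_iff: "w \<in> strip p n \<longleftrightarrow>
    1 \<le> fst w \<and> fst w \<le> n \<and> 1 \<le> snd w \<and> snd w \<le> 6 \<and> even (fst w + snd w + p)"
  by (auto simp: strip_def)

lemma solvable_map:
  assumes h: "\<And>w. w \<in> W \<Longrightarrow> h w \<in> W' \<and> h' (h w) = w"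
    and h': "\<And>w. w \<in> W' \<Longrightarrow> h' w \<in> W \<and> h (h' w) = w"
    and adj: "\<And>u v. \<bar>fst u - fst v\<bar> = 1 \<Longrightarrow> \<bar>snd u - snd v\<bar> = 1 \<Longrightarrow>
      \<bar>fst (h u) - fst (h v)\<bar> = 1 \<and> \<bar>snd (h u) - snd (h v)\<bar> = 1"
    and P': "\<And>w. w \<in> W \<Longrightarrow> P' (h w) = P w" and solv: "solvable W P"
  shows "solvable W' P'"
  unfolding solvable_def
proof
  fix v assume v: "v \<in> W'"
  have "inj_on h W"
    using h by (metis inj_on_inverseI)
  then have "reach (diag_adj W') P' (h (h' v))"
    by (rule reach_map[where A = "diag_adj W" and P = P])
      (use h h'[OF v] adj P' solv in \<open>simp_all add: diag_adj_def solvable_def\<close>)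
  then show "reach (diag_adj W') P' v" using h'[OF v] by simp
qed

text \<open>A relaxation of reachability: a flow need not come from a legal order of moves.\<close>

definition certifies ::
  "(int \<times> int) set \<Rightarrow> (int \<times> int \<Rightarrow> nat) \<Rightarrow> int \<times> int \<Rightarrow> (int \<times> int \<Rightarrow> int \<times> int \<Rightarrow> nat) \<Rightarrow> bool" where
  "certifies W P v f \<longleftrightarrow> (\<forall>u w. f u w \<noteq> 0 \<longrightarrow> diag_adj W u w) \<and>
     (\<forall>w. of_bool (v = w) + 2 * (\<Sum>u\<in>W. f w u) \<le> P w + (\<Sum>u\<in>W. f u w))"

lemma reach_certifies:
  assumes "finite W" "reach (diag_adj W) P v"
  obtains f where "certifies W P v f"
proof -
  from assms(2) obtain Q where Q: "(gmove (diag_adj W))\<^sup>*\<^sup>* P Q" "1 \<le> Q v"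
    unfolding reach_def by blast
  have "\<exists>f :: int \<times> int \<Rightarrow> int \<times> int \<Rightarrow> nat. (\<forall>u w. f u w \<noteq> 0 \<longrightarrow> diag_adj W u w) \<and>
    (\<forall>w. Q w + 2 * (\<Sum>u\<in>W. f w u) = P w + (\<Sum>u\<in>W. f u w))"
    by (rule moves_flow[OF Q(1) assms(1)]) (auto simp: diag_adj_def)
  then obtain f where f1: "\<forall>u w. f u w \<noteq> 0 \<longrightarrow> diag_adj W u w"
    and f2: "\<And>w. Q w + 2 * (\<Sum>u\<in>W. f w u) = P w + (\<Sum>u\<in>W. f u w)"
    by blast
  have "of_bool (v = w) + 2 * (\<Sum>u\<in>W. f w u) \<le> P w + (\<Sum>u\<in>W. f u w)" for w
    unfolding f2[of w, symmetric] using Q(2) by (cases "v = w") simp_all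
  with f1 have "certifies W P v f"
    unfolding certifies_def by blast
  then show ?thesis by (rule that)
qed

lemma certifies_level_balance:
  assumes fin: "finite W" and cert: "certifies W P v f" and v: "v \<in> W" and l: "l = fst \<or> l = snd"
  obtains q' where "1 \<le> q' (l v)"
    "\<And>i. q' i + 2 * (level_flow l W f i (i + 1) + level_flow l W f i (i - 1)) =
      level_sum l W P i + level_flow l W f (i - 1) i + level_flow l W f (i + 1) i"
proof -
  define Q where "Q w = P w + (\<Sum>u\<in>W. f u w) - 2 * (\<Sum>u\<in>W. f w u)" for w
  have le: "of_bool (v = w) + 2 * (\<Sum>u\<in>W. f w u) \<le> P w + (\<Sum>u\<in>W. f u w)" for w
    using cert unfolding certifies_def by blast
  have bal: "Q w + 2 * (\<Sum>u\<in>W. f w u) = P w + (\<Sum>u\<in>W. f u w)" for w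
    using le[of w] unfolding Q_def by simp
  have "1 \<le> Q v"
    using le[of v] unfolding Q_def by simp
  also have "Q v \<le> level_sum l W Q (l v)"
    unfolding level_sum_def by (rule member_le_sum) (use fin v in auto)
  finally show ?thesis
    by (rule that)
      (rule level_balance[OF fin _ bal], use cert l in \<open>auto simp: certifies_def diag_adj_def\<close>)
qed

lemma level_flow_nonzero:
  assumes "level_flow l W f i j \<noteq> 0"
  obtains u v where "u \<in> W" "v \<in> W" "l u = i" "l v = j" "f u v \<noteq> 0"
proof -
  from assms obtain u where "u \<in> {w\<in>W. l w = i}" "(\<Sum>v\<in>{w\<in>W. l w = j}. f u v) \<noteq> 0"
    unfolding level_flow_def by (meson sum.neutral)
  moreover from this obtain v where "v \<in> {w\<in>W. l w = j}" "f u v \<noteq> 0"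
    by (meson sum.neutral)
  ultimately show ?thesis using that by blast
qed

abbreviation col :: "int \<Rightarrow> int \<Rightarrow> (int \<times> int \<Rightarrow> nat) \<Rightarrow> int \<Rightarrow> nat" where
  "col p n P \<equiv> level_sum fst (strip p n) P"

lemma path_load_col: "path_load n (col p n P)"
  by unfold_locales (auto simp: level_sum_def strip_def intro!: sum.neutral)

lemma flow_bounds:
  fixes f :: "int \<times> int \<Rightarrow> int \<times> int \<Rightarrow> nat" and m :: int
  assumes range: "\<And>w. w \<in> W \<Longrightarrow> 1 \<le> l w \<and> l w \<le> m"
    and bal: "\<And>i. q' i + 2 * (level_flow l W f i (i + 1) + level_flow l W f i (i - 1)) =
      level_sum l W P i + level_flow l W f (i - 1) i + level_flow l W f (i + 1) i"
  shows "2 * level_flow l W f i (i + 1) \<le> lload (level_sum l W P) i + level_flow l W f (i + 1) i"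
    "2 * level_flow l W f (i + 1) i \<le> rload m (level_sum l W P) (i + 1) + level_flow l W f i (i + 1)"
proof -
  define x where "x i = level_flow l W f i (i + 1)" for i
  define y where "y i = level_flow l W f (i + 1) i" for i
  have bal': "q' i + 2 * (x i + y (i - 1)) = level_sum l W P i + x (i - 1) + y i" for i
    using bal[of i] by (simp add: x_def y_def)
  have zero: "level_flow l W f j k = 0" if "\<not> (1 \<le> j \<and> j \<le> m \<and> 1 \<le> k \<and> k \<le> m)" for j k
    by (rule ccontr, erule level_flow_nonzero) (use range that in blast)
  have q0: "level_sum l W P j = 0" if "\<not> (1 \<le> j \<and> j \<le> m)" for j
    unfolding level_sum_def using range that by (intro sum.neutral) blast
  have "2 * x i \<le> lload (level_sum l W P) i + y i"
    by (rule lload_bound[where q' = q']) (use bal' q0 zero in \<open>simp_all add: x_def\<close>)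
  then show "2 * level_flow l W f i (i + 1) \<le> lload (level_sum l W P) i + level_flow l W f (i + 1) i"
    unfolding x_def y_def .
  have "2 * y i \<le> rload m (level_sum l W P) (i + 1) + x i"
    by (rule rload_bound[where q' = q']) (use bal' q0 zero in \<open>simp_all add: y_def\<close>)
  then show "2 * level_flow l W f (i + 1) i \<le> rload m (level_sum l W P) (i + 1) + level_flow l W f i (i + 1)"
    unfolding x_def y_def .
qed

lemma strip_range: "w \<in> strip p n \<Longrightarrow> 1 \<le> fst w \<and> fst w \<le> n"
  "w \<in> strip p n \<Longrightarrow> 1 \<le> snd w \<and> snd w \<le> 6"
  by (auto simp: strip_def)

lemma half_bound:
  assumes "2 * a \<le> l + (b :: nat)"
  shows "2 * a \<le> 2 * (l div 2) + 1 + b" "a \<le> l div 2 + 2 * b"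
proof -
  have "l \<le> 2 * (l div 2) + 1" by simp
  with assms show "2 * a \<le> 2 * (l div 2) + 1 + b" by linarith
  then show "a \<le> l div 2 + 2 * b" by linarith
qed

text \<open>A pebble on the column would be the only one it can ever hold. Then no move leaves or
  enters the column, so each of its vertices needs a pebble of its own, and there are at least
  two.\<close>

lemma bad_column:
  assumes solv: "solvable (strip p n) P" and i: "1 \<le> i" "i \<le> n"
    and bad: "\<not> 2 \<le> path_reach n (col p n P) i"
  shows "col p n P i = 0"
    "lload (col p n P) (i - 1) div 2 + rload n (col p n P) (i + 1) div 2 = 1"
proof -
  let ?q = "col p n P" and ?W = "strip p n"
  \<comment> \<open>The lowest row of column \<open>i\<close>.\<close>
  define s where "s = (if even (i + p) then 2 else 1 :: int)"
  have s: "(i, s) \<in> ?W" "(i, s + 2) \<in> ?W"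
    using i by (auto simp: strip_def s_def)
  have main: "?q i + lload ?q (i - 1) div 2 + rload n ?q (i + 1) div 2 = 1 \<and> (?q i = 0 \<or> 1 \<le> P v)"
    if v: "v \<in> ?W" "fst v = i" for v
  proof -
    obtain f where f: "certifies ?W P v f"
      using solv v(1) reach_certifies[OF finite_strip] unfolding solvable_def by blast
    obtain q' where q': "1 \<le> q' (fst v)"
      "\<And>i. q' i + 2 * (level_flow fst ?W f i (i + 1) + level_flow fst ?W f i (i - 1)) =
      ?q i + level_flow fst ?W f (i - 1) i + level_flow fst ?W f (i + 1) i"
      using certifies_level_balance[OF finite_strip f v(1), of fst] by blast
    define x y where "x i = level_flow fst ?W f i (i + 1)"
      and "y i = level_flow fst ?W f (i + 1) i" for i
    have bal: "q' i + 2 * (x i + y (i - 1)) = ?q i + x (i - 1) + y i"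
      using q'(2)[of i] by (simp add: x_def y_def)
    have X: "2 * x (i - 1) \<le> lload ?q (i - 1) + y (i - 1)"
      and Y: "2 * y i \<le> rload n ?q (i + 1) + x i"
      using flow_bounds(1)[where i = "i - 1", OF strip_range(1) q'(2)]
        flow_bounds(2)[where i = i, OF strip_range(1) q'(2)]
      by (simp_all add: x_def y_def)
    define l r where "l = lload ?q (i - 1) div 2" and "r = rload n ?q (i + 1) div 2"
    have lr: "2 * x (i - 1) \<le> 2 * l + 1 + y (i - 1)" "2 * y i \<le> 2 * r + 1 + x i"
      "x (i - 1) \<le> l + 2 * y (i - 1)" "y i \<le> r + 2 * x i"
      using half_bound[OF X] half_bound[OF Y] unfolding l_def r_def by blast+
    have le: "?q i + l + r \<le> 1"
      using bad unfolding path_reach_def l_def r_def by linarith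
    have q1: "1 \<le> q' i" using q'(1) v by simp
    have eq: "?q i + l + r = 1"
      using bal lr q1 le unfolding distrib_left by linarith
    moreover have "1 \<le> P v" if "?q i \<noteq> 0"
    proof -
      have "l = 0" "r = 0" "?q i = 1" using that le by simp_all
      then have "x i = 0" "y (i - 1) = 0"
        using bal lr q1 unfolding distrib_left by linarith+
      then have "x (i - 1) = 0" "y i = 0"
        using lr \<open>l = 0\<close> \<open>r = 0\<close> by simp_all
      have in0: "f u v = 0" if "u \<in> ?W" for u
      proof (rule ccontr)
        assume n0: "f u v \<noteq> 0"
        then have "fst u = i - 1 \<or> fst u = i + 1"
          using f v(2) unfolding certifies_def diag_adj_def by fastforce
        then show False
        proof
          assume u: "fst u = i - 1"
          have "f u v \<le> (\<Sum>v\<in>{w\<in>?W. fst w = i}. f u v)"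
            by (rule member_le_sum) (use v in auto)
          also have "\<dots> \<le> x (i - 1)"
            unfolding x_def level_flow_def
            by simp (rule member_le_sum[where f = "\<lambda>u. \<Sum>v\<in>{w\<in>?W. fst w = i}. f u v"], use u that in auto)
          finally show False using n0 \<open>x (i - 1) = 0\<close> by simp
        next
          assume u: "fst u = i + 1"
          have "f u v \<le> (\<Sum>v\<in>{w\<in>?W. fst w = i}. f u v)"
            by (rule member_le_sum) (use v in auto)
          also have "\<dots> \<le> y i"
            unfolding y_def level_flow_def
            by (rule member_le_sum[where f = "\<lambda>u. \<Sum>v\<in>{w\<in>?W. fst w = i}. f u v"]) (use u that in auto)
          finally show False using n0 \<open>y i = 0\<close> by simp
        qed
      qed
      have "of_bool (v = v) + 2 * (\<Sum>u\<in>?W. f v u) \<le> P v + (\<Sum>u\<in>?W. f u v)"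
        using f unfolding certifies_def by blast
      then show ?thesis using in0 by simp
    qed
    ultimately show ?thesis unfolding l_def r_def by blast
  qed
  show q0: "?q i = 0"
  proof (rule ccontr)
    assume n0: "?q i \<noteq> 0"
    then have "1 \<le> P (i, s)" "1 \<le> P (i, s + 2)"
      using main[of "(i, s)"] main[of "(i, s + 2)"] s by simp_all
    moreover have "P (i, s) + P (i, s + 2) = (\<Sum>w\<in>{(i, s), (i, s + 2)}. P w)"
      by simp
    moreover have "\<dots> \<le> ?q i"
      unfolding level_sum_def by (rule sum_mono2) (use s in auto)
    ultimately have "2 \<le> ?q i" by linarith
    then show False using main[of "(i, s)"] s by simp
  qed
  show "lload ?q (i - 1) div 2 + rload n ?q (i + 1) div 2 = 1"
    using main[of "(i, s)"] s q0 by simp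
qed

section \<open>Splitting at a cut that is never crossed\<close>

lemma level_sum_after_moves:
  assumes moves: "(gmove (diag_adj W'))\<^sup>*\<^sup>* P Q" and sub: "W' \<subseteq> strip p n"
  obtains f where "\<And>u v. f u v \<noteq> 0 \<Longrightarrow> diag_adj W' u v"
    "\<And>i. col p n Q i + 2 * (level_flow fst (strip p n) f i (i + 1) + level_flow fst (strip p n) f i (i - 1)) =
      col p n P i + level_flow fst (strip p n) f (i - 1) i + level_flow fst (strip p n) f (i + 1) i"
proof -
  have "\<exists>f :: int \<times> int \<Rightarrow> int \<times> int \<Rightarrow> nat. (\<forall>u w. f u w \<noteq> 0 \<longrightarrow> diag_adj W' u w) \<and>
    (\<forall>w. Q w + 2 * (\<Sum>u\<in>strip p n. f w u) = P w + (\<Sum>u\<in>strip p n. f u w))"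
    by (rule moves_flow[OF moves finite_strip]) (use sub in \<open>auto simp: diag_adj_def\<close>)
  then obtain f where f: "\<And>u v. f u v \<noteq> 0 \<Longrightarrow> diag_adj W' u v"
    "\<And>w. Q w + 2 * (\<Sum>v\<in>strip p n. f w v) = P w + (\<Sum>u\<in>strip p n. f u w)"
    by blast
  show ?thesis
    by (rule that[OF f(1)], assumption, rule level_balance[OF finite_strip _ f(2)])
      (use f(1) in \<open>auto simp: diag_adj_def\<close>)
qed

text \<open>As long as the cut is not crossed, the two halves run independently. A first crossing
  would need two pebbles in a column next to the cut, gathered from one half alone, but the load
  there is at most 1.\<close>

lemma uncrossable:
  assumes L: "lload (col p n P) i \<le> 1" and R: "rload n (col p n P) (i + 1) \<le> 1"
    and moves: "(gmove (diag_adj (strip p n)))\<^sup>*\<^sup>* P Q"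
  shows "\<exists>Q1 Q2. (gmove (diag_adj {w\<in>strip p n. fst w \<le> i}))\<^sup>*\<^sup>* P Q1 \<and>
    (gmove (diag_adj {w\<in>strip p n. i < fst w}))\<^sup>*\<^sup>* P Q2 \<and>
    (\<forall>w. fst w \<le> i \<longrightarrow> Q1 w = Q w) \<and> (\<forall>w. i < fst w \<longrightarrow> Q2 w = Q w)"
  using moves
proof (induction rule: rtranclp_induct)
  case base
  then show ?case by blast
next
  case (step S Q)
  let ?W = "strip p n"
  let ?A = "diag_adj {w\<in>?W. fst w \<le> i}" and ?B = "diag_adj {w\<in>?W. i < fst w}"
  interpret path_load n "col p n P" by (rule path_load_col)
  from step.IH obtain Q1 Q2 where Q1: "(gmove ?A)\<^sup>*\<^sup>* P Q1" "\<And>w. fst w \<le> i \<Longrightarrow> Q1 w = S w"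
    and Q2: "(gmove ?B)\<^sup>*\<^sup>* P Q2" "\<And>w. i < fst w \<Longrightarrow> Q2 w = S w"
    by blast
  from step.hyps(2) obtain a b where ab: "diag_adj ?W a b" "2 \<le> S a"
    "Q = S(a := S a - 2, b := S b + 1)"
    unfolding gmove_def by blast
  have W: "a \<in> ?W" "b \<in> ?W" "fst b = fst a + 1 \<or> fst b = fst a - 1"
    using ab(1) by (auto simp: diag_adj_def)
  have not_right: "\<not> (fst a \<le> i \<and> i < fst b)"
  proof
    assume "fst a \<le> i \<and> i < fst b"
    then have a: "fst a = i" using W(3) by auto
    obtain f where f: "\<And>u v. f u v \<noteq> 0 \<Longrightarrow> ?A u v"
      and bal: "\<And>i. col p n Q1 i + 2 * (level_flow fst ?W f i (i + 1) + level_flow fst ?W f i (i - 1)) =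
      col p n P i + level_flow fst ?W f (i - 1) i + level_flow fst ?W f (i + 1) i"
      using level_sum_after_moves[OF Q1(1), of p n] by blast
    have zero: "level_flow fst ?W f j k = 0" if "\<not> (j \<le> i \<and> k \<le> i)" for j k
      by (rule ccontr, erule level_flow_nonzero) (use f that in \<open>fastforce simp: diag_adj_def\<close>)
    have "level_flow fst ?W f (i + 1) i = 0" "level_flow fst ?W f i (i + 1) = 0"
      by (rule zero, simp)+
    moreover have "level_flow fst ?W f (i - 1) i \<le> lload (col p n P) (i - 1) div 2 + 2 * level_flow fst ?W f i (i - 1)"
      by (rule half_bound) (use flow_bounds(1)[where i = "i - 1", OF strip_range(1) bal] in simp)
    moreover have "lload (col p n P) i = col p n P i + lload (col p n P) (i - 1) div 2"
      by (rule L_rec)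
    ultimately have "col p n Q1 i \<le> 1"
      using bal[of i] L unfolding distrib_left by linarith
    moreover have "Q1 a \<le> col p n Q1 i"
      unfolding level_sum_def by (rule member_le_sum) (use W a in auto)
    ultimately show False
      using Q1(2)[of a] a ab(2) by simp
  qed
  have not_left: "\<not> (i < fst a \<and> fst b \<le> i)"
  proof
    assume "i < fst a \<and> fst b \<le> i"
    then have a: "fst a = i + 1" using W(3) by auto
    obtain f where f: "\<And>u v. f u v \<noteq> 0 \<Longrightarrow> ?B u v"
      and bal: "\<And>i. col p n Q2 i + 2 * (level_flow fst ?W f i (i + 1) + level_flow fst ?W f i (i - 1)) =
      col p n P i + level_flow fst ?W f (i - 1) i + level_flow fst ?W f (i + 1) i"
      using level_sum_after_moves[OF Q2(1), of p n] by blast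
    have zero: "level_flow fst ?W f j k = 0" if "\<not> (i < j \<and> i < k)" for j k
      by (rule ccontr, erule level_flow_nonzero) (use f that in \<open>fastforce simp: diag_adj_def\<close>)
    have "level_flow fst ?W f (i + 1) i = 0" "level_flow fst ?W f i (i + 1) = 0"
      by (rule zero, simp)+
    moreover have "level_flow fst ?W f (i + 2) (i + 1) \<le>
        rload n (col p n P) (i + 2) div 2 + 2 * level_flow fst ?W f (i + 1) (i + 2)"
      by (rule half_bound) (use flow_bounds(2)[where i = "i + 1", OF strip_range(1) bal] in \<open>simp add: add.assoc\<close>)
    moreover have "rload n (col p n P) (i + 1) = col p n P (i + 1) + rload n (col p n P) (i + 2) div 2"
      using R_rec[of "i + 1"] by (simp add: add.assoc)
    moreover have "col p n Q2 (i + 1) + 2 * (level_flow fst ?W f (i + 1) (i + 2) + level_flow fst ?W f (i + 1) i) =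
      col p n P (i + 1) + level_flow fst ?W f i (i + 1) + level_flow fst ?W f (i + 2) (i + 1)"
      using bal[of "i + 1"] by (simp add: add.assoc)
    ultimately have "col p n Q2 (i + 1) \<le> 1"
      using R unfolding distrib_left by linarith
    moreover have "Q2 a \<le> col p n Q2 (i + 1)"
      unfolding level_sum_def by (rule member_le_sum) (use W a in auto)
    ultimately show False
      using Q2(2)[of a] a ab(2) by simp
  qed
  consider "fst a \<le> i" "fst b \<le> i" | "i < fst a" "i < fst b"
    using not_left not_right by linarith
  then show ?case
  proof cases
    case 1
    then have "gmove ?A Q1 (Q1(a := Q1 a - 2, b := Q1 b + 1))"
      unfolding gmove_def using ab(1,2) Q1(2)
      by (intro exI[of _ a] exI[of _ b]) (simp add: diag_adj_def)
    then have "(gmove ?A)\<^sup>*\<^sup>* P (Q1(a := Q1 a - 2, b := Q1 b + 1))"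
      using Q1(1) by (rule rtranclp.rtrancl_into_rtrancl[rotated])
    moreover have "\<forall>w. fst w \<le> i \<longrightarrow> (Q1(a := Q1 a - 2, b := Q1 b + 1)) w = Q w"
      using Q1(2) 1 by (simp add: ab(3))
    moreover have "\<forall>w. i < fst w \<longrightarrow> Q2 w = Q w"
      using Q2(2) 1 by (auto simp: ab(3))
    ultimately show ?thesis using Q2(1) by blast
  next
    case 2
    then have "gmove ?B Q2 (Q2(a := Q2 a - 2, b := Q2 b + 1))"
      unfolding gmove_def using ab(1,2) Q2(2)
      by (intro exI[of _ a] exI[of _ b]) (simp add: diag_adj_def)
    then have "(gmove ?B)\<^sup>*\<^sup>* P (Q2(a := Q2 a - 2, b := Q2 b + 1))"
      using Q2(1) by (rule rtranclp.rtrancl_into_rtrancl[rotated])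
    moreover have "\<forall>w. i < fst w \<longrightarrow> (Q2(a := Q2 a - 2, b := Q2 b + 1)) w = Q w"
      using Q2(2) 2 by (simp add: ab(3))
    moreover have "\<forall>w. fst w \<le> i \<longrightarrow> Q1 w = Q w"
      using Q1(2) 2 by (auto simp: ab(3))
    ultimately show ?thesis using Q1(1) by blast
  qed
qed

lemma solvable_split:
  assumes solv: "solvable (strip p n) P"
    and L: "lload (col p n P) i \<le> 1" and R: "rload n (col p n P) (i + 1) \<le> 1"
  shows "solvable {w\<in>strip p n. fst w \<le> i} P" "solvable {w\<in>strip p n. i < fst w} P"
proof -
  have "reach (diag_adj {w\<in>strip p n. fst w \<le> i}) P v" if v: "v \<in> strip p n" "fst v \<le> i" for v
  proof -
    obtain Q where Q: "(gmove (diag_adj (strip p n)))\<^sup>*\<^sup>* P Q" "1 \<le> Q v"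
      using solv v unfolding solvable_def reach_def by blast
    then show ?thesis
      using uncrossable[OF L R Q(1)] v(2) unfolding reach_def by metis
  qed
  moreover have "reach (diag_adj {w\<in>strip p n. i < fst w}) P v" if v: "v \<in> strip p n" "i < fst v" for v
  proof -
    obtain Q where Q: "(gmove (diag_adj (strip p n)))\<^sup>*\<^sup>* P Q" "1 \<le> Q v"
      using solv v unfolding solvable_def reach_def by blast
    then show ?thesis
      using uncrossable[OF L R Q(1)] v(2) unfolding reach_def by metis
  qed
  ultimately show "solvable {w\<in>strip p n. fst w \<le> i} P" "solvable {w\<in>strip p n. i < fst w} P"
    unfolding solvable_def by simp_all
qed

section \<open>Symmetries and the rules at the ends\<close>

lemma flip_strip:
  assumes "solvable (strip p n) P"
  shows "solvable (strip (p + 1) n) (\<lambda>w. P (fst w, 7 - snd w))"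
  by (rule solvable_map[where h = "\<lambda>w. (fst w, 7 - snd w)" and h' = "\<lambda>w. (fst w, 7 - snd w)",
        OF _ _ _ _ assms]) (auto simp: strip_iff)

lemma mirror_strip:
  assumes "solvable (strip p n) P"
  shows "solvable (strip (p + n + 1) n) (\<lambda>w. P (n + 1 - fst w, snd w))"
  by (rule solvable_map[where h = "\<lambda>w. (n + 1 - fst w, snd w)" and h' = "\<lambda>w. (n + 1 - fst w, snd w)",
        OF _ _ _ _ assms]) (auto simp: strip_iff)

lemma shift_strip:
  assumes "solvable {w\<in>strip p n. i < fst w} P" "0 \<le> i"
  shows "solvable (strip (p + i) (n - i)) (\<lambda>w. P (fst w + i, snd w))"
  by (rule solvable_map[where h = "\<lambda>w. (fst w - i, snd w)" and h' = "\<lambda>w. (fst w + i, snd w)",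
        OF _ _ _ _ assms(1)]) (use assms(2) in \<open>auto simp: strip_iff\<close>)

lemma col_flip: "col (p + 1) n (\<lambda>w. P (fst w, 7 - snd w)) i = col p n P i"
  unfolding level_sum_def
  by (rule sum.reindex_bij_witness[of _ "\<lambda>w. (fst w, 7 - snd w)" "\<lambda>w. (fst w, 7 - snd w)"])
    (auto simp: strip_iff)

lemma col_mirror: "col (p + n + 1) n (\<lambda>w. P (n + 1 - fst w, snd w)) i = col p n P (n + 1 - i)"
  unfolding level_sum_def
  by (rule sum.reindex_bij_witness[of _ "\<lambda>w. (n + 1 - fst w, snd w)" "\<lambda>w. (n + 1 - fst w, snd w)"])
    (auto simp: strip_iff)

lemma sum_strip_flip: "(\<Sum>w\<in>strip (p + 1) n. P (fst w, 7 - snd w)) = (\<Sum>w\<in>strip p n. P w)"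
  by (rule sum.reindex_bij_witness[of _ "\<lambda>w. (fst w, 7 - snd w)" "\<lambda>w. (fst w, 7 - snd w)"])
    (auto simp: strip_iff)

lemma strip_cases:
  assumes "even (n + 1 + p)" "3 \<le> n"
  shows "{w\<in>strip p n. fst w = n} = {(n, 1), (n, 3), (n, 5)}"
    "{w\<in>strip p n. fst w = n - 1} = {(n - 1, 2), (n - 1, 4), (n - 1, 6)}"
    "{w\<in>strip p n. fst w = n - 2} = {(n - 2, 1), (n - 2, 3), (n - 2, 5)}"
    "{w\<in>strip p n. fst w = n + 1} = {}"
proof -
  have odd: "1 \<le> s \<and> s \<le> 6 \<and> odd s \<longleftrightarrow> s = 1 \<or> s = 3 \<or> s = 5" for s :: int
    by presburger
  have even: "1 \<le> s \<and> s \<le> 6 \<and> even s \<longleftrightarrow> s = 2 \<or> s = 4 \<or> s = 6" for s :: int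
    by presburger
  have par: "even (n + s + p) \<longleftrightarrow> odd s" "even (n - 1 + s + p) \<longleftrightarrow> even s"
    "even (n - 2 + s + p) \<longleftrightarrow> odd s" for s
    using assms(1) by auto
  have range: "1 \<le> n" "1 \<le> n - 1" "1 \<le> n - 2" "n \<le> n" "n - 1 \<le> n" "n - 2 \<le> n"
    using assms(2) by simp_all
  have "(n, s) \<in> strip p n \<longleftrightarrow> 1 \<le> s \<and> s \<le> 6 \<and> odd s"
    "(n - 1, s) \<in> strip p n \<longleftrightarrow> 1 \<le> s \<and> s \<le> 6 \<and> even s"
    "(n - 2, s) \<in> strip p n \<longleftrightarrow> 1 \<le> s \<and> s \<le> 6 \<and> odd s" for s
    unfolding strip_iff fst_conv snd_conv par using range by blast+
  note mem = this[unfolded odd even]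
  show "{w\<in>strip p n. fst w = n} = {(n, 1), (n, 3), (n, 5)}"
    using mem(1) by (auto simp: set_eq_iff)
  show "{w\<in>strip p n. fst w = n - 1} = {(n - 1, 2), (n - 1, 4), (n - 1, 6)}"
    using mem(2) by (auto simp: set_eq_iff)
  show "{w\<in>strip p n. fst w = n - 2} = {(n - 2, 1), (n - 2, 3), (n - 2, 5)}"
    using mem(3) by (auto simp: set_eq_iff)
qed (auto simp: strip_iff)

lemma end_system_certifies:
  assumes cert: "certifies (strip p n) P v f" and v: "v \<in> strip p n"
    and n: "even (n + 1 + p)" "3 \<le> n" and a0: "col p n P n = 0"
  shows "end_system (of_bool (v = (n, 1))) (of_bool (v = (n, 5))) (of_bool (v = (n - 1, 6)))
    (\<lambda>s t. f (n - 1, s) (n, t)) (\<lambda>s t. f (n, s) (n - 1, t))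
    (\<lambda>s t. f (n - 2, s) (n - 1, t)) (\<lambda>s t. f (n - 1, s) (n - 2, t))
    (\<lambda>s. \<Sum>u\<in>{w\<in>strip p n. fst w = n - 3}. f u (n - 2, s))
    (\<lambda>s. \<Sum>u\<in>{w\<in>strip p n. fst w = n - 3}. f (n - 2, s) u)
    (\<lambda>s. P (n - 1, s)) (\<lambda>s. P (n - 2, s)) (lload (col p n P) (n - 3))"
proof -
  let ?W = "strip p n"
  define i where "i s = (\<Sum>u\<in>{w\<in>?W. fst w = n - 3}. f u (n - 2, s))" for s
  define out where "out s = (\<Sum>u\<in>{w\<in>?W. fst w = n - 3}. f (n - 2, s) u)" for s
  have adj: "f u w \<noteq> 0 \<Longrightarrow> \<bar>fst u - fst w\<bar> = 1 \<and> \<bar>snd u - snd w\<bar> = 1" for u w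
    using cert unfolding certifies_def diag_adj_def by blast
  \<comment> \<open>Rows that are not adjacent exchange nothing; this reduces the sums over whole
    columns to the terms of \<open>end_system\<close>.\<close>
  have f0: "f (d, s) (d', s') = 0" if "\<bar>s - s'\<bar> \<noteq> 1" for d s d' s'
    using adj[of "(d, s)" "(d', s')"] that by auto
  have bal: "of_bool (v = w) + 2 * (\<Sum>u\<in>?W. f w u) \<le> P w + (\<Sum>u\<in>?W. f u w)" for w
    using cert unfolding certifies_def by blast
  have outs: "(\<Sum>u\<in>?W. f w u) = (\<Sum>u\<in>{w\<in>?W. fst w = d - 1}. f w u) + (\<Sum>u\<in>{w\<in>?W. fst w = d + 1}. f w u)"
    if "fst w = d" for w d
    by (rule sum_neighbour_levels[OF finite_strip]) (use adj[of w] that in fastforce)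
  have ins: "(\<Sum>u\<in>?W. f u w) = (\<Sum>u\<in>{w\<in>?W. fst w = d - 1}. f u w) + (\<Sum>u\<in>{w\<in>?W. fst w = d + 1}. f u w)"
    if "fst w = d" for w d
    by (rule sum_neighbour_levels[OF finite_strip]) (use adj[of _ w] that in fastforce)
  have P0: "P (n, s) = 0" if "s \<in> {1, 3, 5}" for s
    using a0 that unfolding level_sum_def strip_cases(1)[OF n] by auto
  have A: "of_bool (v = (n, s)) + 2 * (f (n, s) (n - 1, 2) + f (n, s) (n - 1, 4) + f (n, s) (n - 1, 6)) \<le>
    f (n - 1, 2) (n, s) + f (n - 1, 4) (n, s) + f (n - 1, 6) (n, s)" if "s \<in> {1, 3, 5}" for s
    using bal[of "(n, s)"] P0[OF that]
    unfolding outs[of "(n, s)" n, OF fst_conv] ins[of "(n, s)" n, OF fst_conv] strip_cases[OF n] by simp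
  have B: "of_bool (v = (n - 1, s)) +
      2 * (f (n - 1, s) (n, 1) + f (n - 1, s) (n, 3) + f (n - 1, s) (n, 5) +
        f (n - 1, s) (n - 2, 1) + f (n - 1, s) (n - 2, 3) + f (n - 1, s) (n - 2, 5)) \<le>
    P (n - 1, s) + f (n, 1) (n - 1, s) + f (n, 3) (n - 1, s) + f (n, 5) (n - 1, s) +
      f (n - 2, 1) (n - 1, s) + f (n - 2, 3) (n - 1, s) + f (n - 2, 5) (n - 1, s)" for s
  proof -
    have eq: "n - 1 - 1 = n - 2" "n - 1 + 1 = n" by simp_all
    show ?thesis
      using bal[of "(n - 1, s)"]
      unfolding outs[of "(n - 1, s)" "n - 1", OF fst_conv] ins[of "(n - 1, s)" "n - 1", OF fst_conv]
        eq strip_cases[OF n] by simp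
  qed
  have D: "2 * (f (n - 2, s) (n - 1, 2) + f (n - 2, s) (n - 1, 4) + f (n - 2, s) (n - 1, 6) + out s) \<le>
    P (n - 2, s) + f (n - 1, 2) (n - 2, s) + f (n - 1, 4) (n - 2, s) + f (n - 1, 6) (n - 2, s) + i s" for s
  proof -
    have eq: "n - 2 - 1 = n - 3" "n - 2 + 1 = n - 1" by simp_all
    show ?thesis
      using bal[of "(n - 2, s)"]
      unfolding outs[of "(n - 2, s)" "n - 2", OF fst_conv] ins[of "(n - 2, s)" "n - 2", OF fst_conv]
        eq strip_cases[OF n] i_def out_def by simp
  qed
  obtain q' where q': "\<And>i. q' i + 2 * (level_flow fst ?W f i (i + 1) + level_flow fst ?W f i (i - 1)) =
      col p n P i + level_flow fst ?W f (i - 1) i + level_flow fst ?W f (i + 1) i"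
    using certifies_level_balance[OF finite_strip cert v, of fst] by blast
  have "level_flow fst ?W f (n - 3) (n - 2) = i 1 + i 3 + i 5"
    unfolding level_flow_def i_def strip_cases[OF n] by (simp add: sum.distrib)
  moreover have "level_flow fst ?W f (n - 2) (n - 3) = out 1 + out 3 + out 5"
    unfolding level_flow_def out_def strip_cases[OF n] by simp
  ultimately have G: "2 * (i 1 + i 3 + i 5) \<le> lload (col p n P) (n - 3) + out 1 + out 3 + out 5"
    using flow_bounds(1)[where m = n and i = "n - 3", OF strip_range(1)[of _ p n] q'] by simp
  show ?thesis
    unfolding i_def[symmetric] out_def[symmetric]
  proof
    show "of_bool (v = (n, 1)) + 2 * f (n,1) (n-1,2) \<le> f (n-1,2) (n,1)"
      using A[of 1] by (simp add: f0)
    show "2 * (f (n,3) (n-1,2) + f (n,3) (n-1,4)) \<le> f (n-1,2) (n,3) + f (n-1,4) (n,3)"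
      using A[of 3] by (simp add: f0)
    show "of_bool (v = (n, 5)) + 2 * (f (n,5) (n-1,4) + f (n,5) (n-1,6)) \<le> f (n-1,4) (n,5) + f (n-1,6) (n,5)"
      using A[of 5] by (simp add: f0)
    show "2 * (f (n-1,2) (n,1) + f (n-1,2) (n,3) + f (n-1,2) (n-2,1) + f (n-1,2) (n-2,3)) \<le>
      P (n-1,2) + f (n,1) (n-1,2) + f (n,3) (n-1,2) + f (n-2,1) (n-1,2) + f (n-2,3) (n-1,2)"
      using B[of 2] by (simp add: f0)
    show "2 * (f (n-1,4) (n,3) + f (n-1,4) (n,5) + f (n-1,4) (n-2,3) + f (n-1,4) (n-2,5)) \<le>
      P (n-1,4) + f (n,3) (n-1,4) + f (n,5) (n-1,4) + f (n-2,3) (n-1,4) + f (n-2,5) (n-1,4)"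
      using B[of 4] by (simp add: f0)
    show "of_bool (v = (n - 1, 6)) + 2 * (f (n-1,6) (n,5) + f (n-1,6) (n-2,5)) \<le>
      P (n-1,6) + f (n,5) (n-1,6) + f (n-2,5) (n-1,6)"
      using B[of 6] by (simp add: f0)
    show "2 * (f (n-2,1) (n-1,2) + out 1) \<le> P (n-2,1) + f (n-1,2) (n-2,1) + i 1"
      using D[of 1] by (simp add: f0)
    show "2 * (f (n-2,3) (n-1,2) + f (n-2,3) (n-1,4) + out 3) \<le>
      P (n-2,3) + f (n-1,2) (n-2,3) + f (n-1,4) (n-2,3) + i 3"
      using D[of 3] by (simp add: f0)
    show "2 * (f (n-2,5) (n-1,4) + f (n-2,5) (n-1,6) + out 5) \<le>
      P (n-2,5) + f (n-1,4) (n-2,5) + f (n-1,6) (n-2,5) + i 5"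
      using D[of 5] by (simp add: f0)
    show "2 * (i 1 + i 3 + i 5) \<le> lload (col p n P) (n - 3) + out 1 + out 3 + out 5"
      by (rule G)
  qed
qed

text \<open>This parity puts rows 1, 3 and 5 into column \<open>n\<close>, so \<open>(n, 1)\<close>
  has a single neighbour. The three targets have separate flows but share the pebbles
  \<open>B\<close> and \<open>D\<close>; what one target forces about these contradicts
  another.\<close>

lemma right_rules_even:
  assumes solv: "solvable (strip p n) P" and n: "even (n + 1 + p)" "3 \<le> n"
    and q0: "col p n P n = 0" and L: "lload (col p n P) (n - 1) div 2 = 1"
  shows "right_rules n (col p n P)"
proof -
  interpret path_load n "col p n P" by (rule path_load_col)
  let ?q = "col p n P"
  define B D where defs: "B = (\<lambda>s. P (n - 1, s))" "D = (\<lambda>s. P (n - 2, s))"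
  let ?Lg = "L (n - 3)"
  have qc: "?q (n - 1) = B 2 + B 4 + B 6"
    unfolding level_sum_def strip_cases[OF n] defs by simp
  have qe: "?q (n - 2) = D 1 + D 3 + D 5"
    unfolding level_sum_def strip_cases[OF n] defs by simp
  have Le: "L (n - 2) = D 1 + D 3 + D 5 + ?Lg div 2"
    using L_rec[of "n - 2"] qe by simp
  have Lc: "L (n - 1) = B 2 + B 4 + B 6 + L (n - 2) div 2"
    using L_rec[of "n - 1"] qc by simp
  have ex: "\<exists>ba ab db bd i out. end_system (of_bool (v = (n, 1))) (of_bool (v = (n, 5)))
    (of_bool (v = (n - 1, 6))) ba ab db bd i out B D ?Lg" if "v \<in> strip p n" for v
  proof -
    have "reach (diag_adj (strip p n)) P v"
      using solv that unfolding solvable_def by blast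
    then obtain f where f: "certifies (strip p n) P v f"
      by (rule reach_certifies[OF finite_strip])
    show ?thesis
      unfolding defs by (intro exI) (rule end_system_certifies[OF f that n q0])
  qed
  have v: "(n, 1) \<in> strip p n" "(n, 5) \<in> strip p n" "(n - 1, 6) \<in> strip p n"
    using n by (simp_all add: strip_iff)
  obtain ba ab db bd i out where A1: "end_system 1 0 0 ba ab db bd i out B D ?Lg"
    using ex[OF v(1)] by auto
  obtain ba ab db bd i out where A3: "end_system 0 1 0 ba ab db bd i out B D ?Lg"
    using ex[OF v(2)] by auto
  obtain ba ab db bd i out where B3: "end_system 0 0 1 ba ab db bd i out B D ?Lg"
    using ex[OF v(3)] by auto
  have L23: "L (n - 1) = 2 \<or> L (n - 1) = 3" using L by presburger
  have r1: "L (n - 1) = 3" if "?q (n - 1) = 1"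
  proof (rule ccontr)
    assume "\<not> ?thesis"
    then have "L (n - 2) div 2 = 1" "B 2 + B 4 + B 6 = 1"
      using L23 Lc qc that by simp_all
    moreover from this have "D 1 + D 3 + D 5 + ?Lg div 2 \<le> 3"
      unfolding Le[symmetric] by presburger
    ultimately show False
      using end_system.one_pebble_a1[OF A1] end_system.one_pebble_a3[OF A3] by simp
  qed
  have r3: "L (n - 1) = 3" if "?q (n - 1) = 2"
  proof (rule ccontr)
    assume "\<not> ?thesis"
    then have "L (n - 2) div 2 = 0" "B 2 + B 4 + B 6 = 2"
      using L23 Lc qc that by simp_all
    moreover from this have "D 1 + D 3 + D 5 + ?Lg div 2 \<le> 1"
      unfolding Le[symmetric] by presburger
    ultimately show False
      using end_system.two_unfed_a1[OF A1] end_system.two_unfed_a3[OF A3] by simp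
  qed
  have r2: "?q (n - 2) = 0" if "?q (n - 1) = 2" "L (n - 2) = 2"
  proof (rule ccontr)
    assume "\<not> ?thesis"
    then have "1 \<le> D 1 + D 3 + D 5" using qe by linarith
    moreover have "B 2 + B 4 + B 6 = 2" "D 1 + D 3 + D 5 + ?Lg div 2 = 2"
      using that qc Le by simp_all
    ultimately have e: "B 2 + B 4 + B 6 = 2" "D 1 + D 3 + D 5 + ?Lg div 2 = 2" "1 \<le> D 1 + D 3 + D 5"
      by blast+
    have "1 \<le> B 2" "1 \<le> B 4 + B 6"
      using end_system.two_fed_a1[OF A1] end_system.two_fed_a3[OF A3] e by simp_all
    then have B: "B 2 = 1" "B 4 = 0 \<and> B 6 = 1 \<or> B 4 = 1 \<and> B 6 = 0"
      using e by auto
    then have "D 5 = 0"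
      using end_system.two_fed_a1'[OF A1] e by simp
    then show False
      using B(2) end_system.two_fed_a3'[OF A3 _ _ e] end_system.two_fed_b3[OF B3] B(1) e by auto
  qed
  have r4: "3 \<le> ?Lg" if "?q (n - 1) = 0" "L (n - 2) = 4"
  proof (rule ccontr)
    assume "\<not> ?thesis"
    then have e: "B 2 + B 4 + B 6 = 0" "D 1 + D 3 + D 5 + ?Lg div 2 = 4" "?Lg \<le> 2"
      using that qc Le by simp_all
    have "D 5 = 0"
      using end_system.none_fed_a1[OF A1 _ _ e] by simp
    then show False
      using end_system.none_fed_b3[OF B3 _ _ _ e] by simp
  qed
  show ?thesis
    unfolding right_rules_def using q0 L r1 r2 r3 r4 by blast
qed

lemma right_rules_strip:
  assumes "solvable (strip p n) P" "3 \<le> n"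
    and "col p n P n = 0" "lload (col p n P) (n - 1) div 2 = 1"
  shows "right_rules n (col p n P)"
proof (cases "even (n + 1 + p)")
  case True
  then show ?thesis by (rule right_rules_even[OF assms(1) _ assms(2-)])
next
  case False
  have eq: "col (p + 1) n (\<lambda>w. P (fst w, 7 - snd w)) = col p n P"
    by (rule ext) (rule col_flip)
  have "right_rules n (col (p + 1) n (\<lambda>w. P (fst w, 7 - snd w)))"
    by (rule right_rules_even[OF flip_strip[OF assms(1)]]) (use False assms in \<open>simp_all add: eq\<close>)
  then show ?thesis unfolding eq .
qed

lemma left_rules_strip:
  assumes "solvable (strip p n) P" "3 \<le> n"
    and "col p n P 1 = 0" "rload n (col p n P) 2 div 2 = 1"
  shows "right_rules n (\<lambda>j. col p n P (n + 1 - j))"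
proof -
  have eq: "col (p + n + 1) n (\<lambda>w. P (n + 1 - fst w, snd w)) = (\<lambda>j. col p n P (n + 1 - j))"
    by (rule ext) (rule col_mirror)
  have "right_rules n (col (p + n + 1) n (\<lambda>w. P (n + 1 - fst w, snd w)))"
    by (rule right_rules_strip[OF mirror_strip[OF assms(1)]])
      (use assms in \<open>simp_all add: eq lload_reflect\<close>)
  then show ?thesis unfolding eq .
qed

section \<open>Strips of length two and three\<close>

lemma sum_level_sum:
  assumes "finite W" "\<And>w. w \<in> W \<Longrightarrow> 1 \<le> l w \<and> l w \<le> m"
  shows "(\<Sum>i\<in>{1..m}. level_sum l W P i) = (\<Sum>w\<in>W. P w)"
  unfolding level_sum_def by (rule sum.group) (use assms in auto)

lemma reach_path_reach:
  assumes "finite W" "\<And>w. w \<in> W \<Longrightarrow> 1 \<le> l w \<and> l w \<le> m" "l = fst \<or> l = snd"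
    and "reach (diag_adj W) P v" "v \<in> W"
  shows "1 \<le> path_reach m (level_sum l W P) (l v)"
proof -
  let ?q = "level_sum l W P" and ?i = "l v"
  obtain f where f: "certifies W P v f"
    using assms(1,4) by (rule reach_certifies)
  obtain q' where q': "1 \<le> q' ?i"
    "\<And>i. q' i + 2 * (level_flow l W f i (i + 1) + level_flow l W f i (i - 1)) =
      ?q i + level_flow l W f (i - 1) i + level_flow l W f (i + 1) i"
    by (rule certifies_level_balance[OF assms(1) f assms(5,3)]) blast
  have "2 * level_flow l W f (?i - 1) ?i \<le> lload ?q (?i - 1) + level_flow l W f ?i (?i - 1)"
    using flow_bounds(1)[where i = "?i - 1", OF assms(2) q'(2)] by simp
  then have "level_flow l W f (?i - 1) ?i \<le> lload ?q (?i - 1) div 2 + 2 * level_flow l W f ?i (?i - 1)"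
    by (rule half_bound)
  moreover have "2 * level_flow l W f (?i + 1) ?i \<le> rload m ?q (?i + 1) + level_flow l W f ?i (?i + 1)"
    by (rule flow_bounds(2)[OF assms(2) q'(2)])
  then have "level_flow l W f (?i + 1) ?i \<le> rload m ?q (?i + 1) div 2 + 2 * level_flow l W f ?i (?i + 1)"
    by (rule half_bound)
  ultimately show ?thesis
    using q'(1) q'(2)[of ?i] unfolding path_reach_def distrib_left by linarith
qed

section \<open>At most four pebbles on the path with six vertices\<close>

text \<open>\<open>r\<close> is the load of the vertex next to the third one. A lone pebble cannot
  move, so \<open>r\<close> must send a pebble at least to the second vertex.\<close>

lemma half_path:
  fixes t1 t2 t3 r :: nat
  assumes "1 \<le> t1 + (t2 + (t3 + r div 2) div 2) div 2"
    and "1 \<le> t2 + t1 div 2 + (t3 + r div 2) div 2"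
    and "1 \<le> t3 + (t2 + t1 div 2) div 2 + r div 2"
    and "t1 + t2 + t3 \<le> 1"
  shows "4 \<le> r"
proof (rule ccontr)
  let ?S = "{(0, 0, 0), (1, 0, 0), (0, 1, 0), (0, 0, 1)} :: (nat \<times> nat \<times> nat) set"
  assume "\<not> 4 \<le> r"
  then have r: "r \<in> {0, 1, 2, 3}" by auto
  have t: "(t1, t2, t3) \<in> ?S"
    using assms(4) by (cases t1; cases t2; cases t3) simp_all
  have "\<forall>r\<in>{0, 1, 2, 3 :: nat}. \<forall>(t1, t2, t3)\<in>?S.
    1 \<le> t1 + (t2 + (t3 + r div 2) div 2) div 2 \<longrightarrow>
    1 \<le> t2 + t1 div 2 + (t3 + r div 2) div 2 \<longrightarrow>
    1 \<le> t3 + (t2 + t1 div 2) div 2 + r div 2 \<longrightarrow> False"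
    by code_simp
  from this[rule_format, OF r t, unfolded prod.case, rule_format, OF assms(1-3)]
  show False .
qed

definition two_of_three :: "(nat \<times> nat \<times> nat) set" where
  "two_of_three = {(2, 0, 0), (0, 2, 0), (0, 0, 2), (1, 1, 0), (1, 0, 1), (0, 1, 1)}"

lemma two_of_three: "a + b + c = 2 \<Longrightarrow> (a, b, c) \<in> two_of_three"
  unfolding two_of_three_def
  by (cases a; cases "a - 1"; cases b; cases "b - 1"; simp)

text \<open>The inequalities express reachability on the path with all loads unfolded, which leaves
  36 cases to evaluation.\<close>

lemma six_path_enum:
  "\<forall>(a, b, c)\<in>two_of_three. \<forall>(d, e, f)\<in>two_of_three.
    1 \<le> a + (b + (c + (d + (e + f div 2) div 2) div 2) div 2) div 2 \<longrightarrow>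
    1 \<le> b + a div 2 + (c + (d + (e + f div 2) div 2) div 2) div 2 \<longrightarrow>
    1 \<le> c + (b + a div 2) div 2 + (d + (e + f div 2) div 2) div 2 \<longrightarrow>
    1 \<le> d + (c + (b + a div 2) div 2) div 2 + (e + f div 2) div 2 \<longrightarrow>
    1 \<le> e + (d + (c + (b + a div 2) div 2) div 2) div 2 + f div 2 \<longrightarrow>
    1 \<le> f + (e + (d + (c + (b + a div 2) div 2) div 2) div 2) div 2 \<longrightarrow>
    a = 0 \<and> b = 2 \<and> c = 0 \<and> d = 0 \<and> e = 2 \<and> f = 0"
  by code_simp

text \<open>If one half had at most one pebble, the load of the other would have to be 4. Then all
  four pebbles lie in that other half, and load 4 dies out before the outer vertex. So each half has
  exactly two.\<close>

lemma six_path: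
  assumes "path_load 6 q" and good: "\<And>i. i \<in> {1..6} \<Longrightarrow> 1 \<le> path_reach 6 q i"
    and total: "(\<Sum>i\<in>{1..6}. q i) \<le> 4"
  shows "q 1 = 0 \<and> q 2 = 2 \<and> q 3 = 0 \<and> q 4 = 0 \<and> q 5 = 2 \<and> q 6 = 0"
proof -
  interpret path_load 6 q by fact
  have L: "L 1 = q 1" "L 2 = q 2 + L 1 div 2" "L 3 = q 3 + L 2 div 2" "L 4 = q 4 + L 3 div 2"
    "L 5 = q 5 + L 4 div 2"
    by (subst L_rec, simp)+
  have R: "R 6 = q 6" "R 5 = q 5 + R 6 div 2" "R 4 = q 4 + R 5 div 2" "R 3 = q 3 + R 4 div 2"
    "R 2 = q 2 + R 3 div 2"
    by (subst R_rec, simp)+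
  have reach: "path_reach 6 q 1 = q 1 + R 2 div 2" "path_reach 6 q 2 = q 2 + L 1 div 2 + R 3 div 2"
    "path_reach 6 q 3 = q 3 + L 2 div 2 + R 4 div 2" "path_reach 6 q 4 = q 4 + L 3 div 2 + R 5 div 2"
    "path_reach 6 q 5 = q 5 + L 4 div 2 + R 6 div 2" "path_reach 6 q 6 = q 6 + L 5 div 2"
    by (simp_all add: path_reach_def)
  have g: "1 \<le> path_reach 6 q 1" "1 \<le> path_reach 6 q 2" "1 \<le> path_reach 6 q 3"
    "1 \<le> path_reach 6 q 4" "1 \<le> path_reach 6 q 5" "1 \<le> path_reach 6 q 6"
    by (rule good, simp)+
  note g = this[unfolded reach]
  have "{1..6::int} = {1, 2, 3, 4, 5, 6}" by auto
  then have tot: "q 1 + q 2 + q 3 + q 4 + q 5 + q 6 \<le> 4" using total by simp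
  have le: "a + b div 2 \<le> a + b" for a b :: nat by simp
  have "R 4 \<le> q 4 + R 5" "R 5 \<le> q 5 + R 6"
    by (subst R, rule le)+
  then have R4: "R 4 \<le> q 4 + q 5 + q 6" using R(1) by linarith
  have "L 3 \<le> q 3 + L 2" "L 2 \<le> q 2 + L 1"
    by (subst L, rule le)+
  then have L3: "L 3 \<le> q 1 + q 2 + q 3" using L(1) by linarith
  have A: "2 \<le> q 1 + q 2 + q 3"
  proof (rule ccontr)
    assume "\<not> ?thesis"
    then have small: "q 1 + q 2 + q 3 \<le> 1" by simp
    have "4 \<le> R 4"
      using half_path[OF _ _ _ small, of "R 4"] g(1-3) unfolding R(5) R(4) L(2) L(1) by blast
    then have "R 4 = 4" "q 1 = 0" "q 2 = 0" "q 3 = 0" using R4 tot by linarith+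
    then show False using g(1) unfolding R(5) R(4) by simp
  qed
  have B: "2 \<le> q 6 + q 5 + q 4"
  proof (rule ccontr)
    assume "\<not> ?thesis"
    then have small: "q 6 + q 5 + q 4 \<le> 1" by simp
    have "1 \<le> q 5 + q 6 div 2 + (q 4 + L 3 div 2) div 2"
      using g(5) unfolding L(4) R(1) by (simp only: ac_simps)
    moreover have "1 \<le> q 4 + (q 5 + q 6 div 2) div 2 + L 3 div 2"
      using g(4) unfolding R(2) R(1) by (simp only: ac_simps)
    ultimately have "4 \<le> L 3"
      using half_path[OF _ _ _ small, of "L 3"] g(6) unfolding L(5) L(4) by blast
    then have "L 3 = 4" "q 6 = 0" "q 5 = 0" "q 4 = 0" using L3 tot by linarith+
    then show False using g(6) unfolding L(5) L(4) by simp
  qed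
  have "q 1 + q 2 + q 3 = 2" "q 4 + q 5 + q 6 = 2"
    using A B tot by linarith+
  then have "(q 1, q 2, q 3) \<in> two_of_three" "(q 4, q 5, q 6) \<in> two_of_three"
    by (simp_all add: two_of_three)
  from bspec[OF bspec[OF six_path_enum this(1), unfolded prod.case] this(2), unfolded prod.case]
  show ?thesis
    using g unfolding L R by blast
qed

abbreviation row :: "int \<Rightarrow> int \<Rightarrow> (int \<times> int \<Rightarrow> nat) \<Rightarrow> int \<Rightarrow> nat" where
  "row p n P \<equiv> level_sum snd (strip p n) P"

lemma path_load_row: "path_load 6 (row p n P)"
  by unfold_locales (auto simp: level_sum_def strip_iff intro!: sum.neutral)

lemma sum_row: "(\<Sum>i\<in>{1..6}. row p n P i) = (\<Sum>w\<in>strip p n. P w)"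
  by (rule sum_level_sum) (auto simp: strip_iff)

lemma sum_col: "(\<Sum>i\<in>{1..n}. col p n P i) = (\<Sum>w\<in>strip p n. P w)"
  by (rule sum_level_sum) (auto simp: strip_iff)

lemma small_rows:
  assumes solv: "solvable (strip p n) P" and n: "2 \<le> n" and size: "(\<Sum>w\<in>strip p n. P w) \<le> 4"
  shows "row p n P 1 = 0 \<and> row p n P 2 = 2 \<and> row p n P 3 = 0 \<and>
    row p n P 4 = 0 \<and> row p n P 5 = 2 \<and> row p n P 6 = 0"
proof (rule six_path[OF path_load_row])
  show "1 \<le> path_reach 6 (row p n P) s" if s: "s \<in> {1..6}" for s
  proof -
    define d where "d = (if even (1 + s + p) then 1 else 2 :: int)"
    have v: "(d, s) \<in> strip p n"
      using s n by (auto simp: strip_iff d_def)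
    then have r: "reach (diag_adj (strip p n)) P (d, s)"
      using solv unfolding solvable_def by blast
    show ?thesis
      using reach_path_reach[where l = snd and m = 6, OF finite_strip _ _ r v] by (simp add: strip_iff)
  qed
  show "(\<Sum>i\<in>{1..6}. row p n P i) \<le> 4"
    using size unfolding sum_row .
qed

lemma strip_2_bound:
  assumes "solvable (strip p 2) P"
  shows "3 \<le> (\<Sum>w\<in>strip p 2. P w)"
proof (rule ccontr)
  assume a: "\<not> ?thesis"
  then have "row p 2 P 2 = 2" "row p 2 P 5 = 2"
    using small_rows[OF assms] by simp_all
  moreover have "row p 2 P 2 + row p 2 P 5 = (\<Sum>i\<in>{2, 5}. row p 2 P i)" by simp
  moreover have "\<dots> \<le> (\<Sum>i\<in>{1..6}. row p 2 P i)"
    by (rule sum_mono2) auto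
  moreover have "\<dots> = (\<Sum>w\<in>strip p 2. P w)"
    by (rule sum_row)
  ultimately show False using a by linarith
qed

section \<open>Strips of length three\<close>

lemma flow_le_level_flow:
  assumes "finite W" "u \<in> W" "v \<in> W"
  shows "f u v \<le> level_flow l W f (l u) (l v)"
proof -
  have "f u v \<le> (\<Sum>v\<in>{w\<in>W. l w = l v}. f u v)"
    by (rule member_le_sum) (use assms in auto)
  also have "\<dots> \<le> level_flow l W f (l u) (l v)"
    unfolding level_flow_def
    by (rule member_le_sum[where f = "\<lambda>u. \<Sum>v\<in>{w\<in>W. l w = l v}. f u v"]) (use assms in auto)
  finally show ?thesis .
qed

text \<open>Row 5 consists of \<open>(1, 5)\<close> and \<open>(3, 5)\<close>, row 6 of
  \<open>(2, 6)\<close>, and nothing arrives from row 4. The two pebbles of row 5 miss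
  \<open>(2, 6)\<close> if they are apart, and the other vertex of row 5 if they are
  together.\<close>

lemma strip_3_bound_even:
  assumes solv: "solvable (strip p 3) P" and p: "even p"
  shows "5 \<le> (\<Sum>w\<in>strip p 3. P w)"
proof (rule ccontr)
  let ?W = "strip p 3"
  assume "\<not> ?thesis"
  then have row: "row p 3 P 1 = 0" "row p 3 P 2 = 2" "row p 3 P 3 = 0" "row p 3 P 4 = 0"
    "row p 3 P 5 = 2" "row p 3 P 6 = 0"
    using small_rows[OF solv] by simp_all
  interpret path_load 6 "row p 3 P" by (rule path_load_row)
  have "L 1 = 0" "L 2 = 2 + L 1 div 2" "L 3 = L 2 div 2" "L 4 = L 3 div 2"
    by (subst L_rec, simp add: row)+
  then have L4: "L 4 = 0" by simp
  have "R 6 = 0" "R 5 = 2 + R 6 div 2"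
    by (subst R_rec, simp add: row)+
  then have R5: "R 5 = 2" by simp
  have mem: "(1, 5) \<in> ?W" "(3, 5) \<in> ?W" "(2, 4) \<in> ?W" "(2, 6) \<in> ?W"
    using p by (simp_all add: strip_iff)
  have row5: "d = 1 \<or> d = 3" if "(d, 5) \<in> ?W" for d
  proof -
    have "d = 1 \<or> d = 2 \<or> d = 3" "even (d + 5 + p)"
      using that unfolding strip_iff by auto
    then show ?thesis using p by auto
  qed
  have "{w\<in>?W. snd w = 5} = {(1, 5), (3, 5)}"
    using mem(1,2) by (auto dest: row5)
  then have P5: "P (1, 5) + P (3, 5) = 2"
    using row(5) by (simp add: level_sum_def)
  have "P (2, 6) \<le> row p 3 P 6"
    unfolding level_sum_def by (rule member_le_sum) (use mem in auto)
  then have P6: "P (2, 6) = 0" using row(6) by simp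
  \<comment> \<open>\<open>a\<close> and \<open>b\<close> are the flows from row 5 up to
    \<open>(2, 6)\<close>, \<open>c\<close> and \<open>d\<close> the flows back.\<close>
  have flow: "\<exists>a b c d. of_bool (v = (2, 6)) + 2 * (c + d) \<le> a + b \<and>
      of_bool (v = (1, 5)) + 2 * a \<le> P (1, 5) + c \<and>
      of_bool (v = (3, 5)) + 2 * b \<le> P (3, 5) + (d :: nat)" if v: "v \<in> ?W" for v
  proof -
    have "reach (diag_adj ?W) P v"
      using solv v unfolding solvable_def by blast
    then obtain f where f: "certifies ?W P v f"
      by (rule reach_certifies[OF finite_strip])
    obtain q' where q': "\<And>i. q' i + 2 * (level_flow snd ?W f i (i + 1) + level_flow snd ?W f i (i - 1)) =
      row p 3 P i + level_flow snd ?W f (i - 1) i + level_flow snd ?W f (i + 1) i"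
      by (rule certifies_level_balance[OF finite_strip f v, of snd]) blast+
    have "2 * level_flow snd ?W f 4 5 \<le> L 4 + level_flow snd ?W f 5 4"
      using flow_bounds(1)[where i = 4, OF strip_range(2) q'] by simp
    moreover have "2 * level_flow snd ?W f 5 4 \<le> R 5 + level_flow snd ?W f 4 5"
      using flow_bounds(2)[where i = 4, OF strip_range(2) q'] by simp
    ultimately have "level_flow snd ?W f 4 5 = 0"
      using L4 R5 by linarith
    then have z: "f (2, 4) (1, 5) = 0" "f (2, 4) (3, 5) = 0"
      using flow_le_level_flow[of ?W "(2, 4)" "(1, 5)" f snd] flow_le_level_flow[of ?W "(2, 4)" "(3, 5)" f snd]
        mem by simp_all
    have adj: "f u w = 0" if "\<not> (w \<in> ?W \<and> u \<in> ?W \<and> \<bar>fst u - fst w\<bar> = 1 \<and> \<bar>snd u - snd w\<bar> = 1)" for u w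
      using f that unfolding certifies_def diag_adj_def by blast
    have bal: "of_bool (v = w) + 2 * (\<Sum>u\<in>?W. f w u) \<le> P w + (\<Sum>u\<in>?W. f u w)" for w
      using f unfolding certifies_def by blast
    have nbr: "w = (2, 4) \<or> w = (2, 6)" if "w \<in> ?W" "\<bar>fst w - d\<bar> = 1" "\<bar>snd w - 5\<bar> = 1" "d = 1 \<or> d = 3" for w d
      using that by (cases w) (auto simp: abs_eq_iff' strip_iff)
    have nbr6: "w = (1, 5) \<or> w = (3, 5)" if "w \<in> ?W" "\<bar>fst w - 2\<bar> = 1" "\<bar>snd w - 6\<bar> = 1" for w
      using that by (cases w) (auto simp: abs_eq_iff' strip_iff)
    have in5: "(\<Sum>u\<in>?W. f u (d, 5)) = f (2, 6) (d, 5)" if d: "d = 1 \<or> d = 3" for d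
    proof -
      have "(\<Sum>u\<in>?W. f u (d, 5)) = (\<Sum>u\<in>{(2, 4), (2, 6)}. f u (d, 5))"
        by (rule sum.mono_neutral_right) (use mem nbr[OF _ _ _ d] adj[of "(d, 5)"] in \<open>auto, fastforce+\<close>)
      then show ?thesis using z d by auto
    qed
    have out5: "f (d, 5) (2, 6) \<le> (\<Sum>u\<in>?W. f (d, 5) u)" for d
      by (rule member_le_sum) (use mem in auto)
    have in6: "(\<Sum>u\<in>?W. f u (2, 6)) = f (1, 5) (2, 6) + f (3, 5) (2, 6)"
    proof -
      have "(\<Sum>u\<in>?W. f u (2, 6)) = (\<Sum>u\<in>{(1, 5), (3, 5)}. f u (2, 6))"
        by (rule sum.mono_neutral_right) (use mem nbr6 adj[of "(2, 6)"] in \<open>auto, fastforce+\<close>)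
      then show ?thesis by simp
    qed
    have "f (2, 6) (1, 5) + f (2, 6) (3, 5) = (\<Sum>u\<in>{(1, 5), (3, 5)}. f (2, 6) u)" by simp
    also have "\<dots> \<le> (\<Sum>u\<in>?W. f (2, 6) u)"
      by (rule sum_mono2) (use mem in auto)
    finally have out6: "f (2, 6) (1, 5) + f (2, 6) (3, 5) \<le> (\<Sum>u\<in>?W. f (2, 6) u)" .
    have "of_bool (v = (2, 6)) + 2 * (f (2, 6) (1, 5) + f (2, 6) (3, 5)) \<le> f (1, 5) (2, 6) + f (3, 5) (2, 6)"
      using bal[of "(2, 6)"] in6 out6 P6 unfolding distrib_left by linarith
    moreover have "of_bool (v = (1, 5)) + 2 * f (1, 5) (2, 6) \<le> P (1, 5) + f (2, 6) (1, 5)"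
      using bal[of "(1, 5)"] in5[of 1] out5[of 1] by linarith
    moreover have "of_bool (v = (3, 5)) + 2 * f (3, 5) (2, 6) \<le> P (3, 5) + f (2, 6) (3, 5)"
      using bal[of "(3, 5)"] in5[of 3] out5[of 3] by linarith
    ultimately show ?thesis by blast
  qed
  consider "P (1, 5) = 1" "P (3, 5) = 1" | "P (1, 5) = 2" "P (3, 5) = 0" | "P (1, 5) = 0" "P (3, 5) = 2"
    using P5 by linarith
  then show False
  proof cases
    case 1
    obtain a b c d where f: "1 + 2 * (c + d) \<le> a + b" "2 * a \<le> 1 + c" "2 * b \<le> 1 + (d :: nat)"
      using flow[OF mem(4)] 1 by auto
    then have "c = 0" "d = 0" unfolding distrib_left by linarith+
    then have "a = 0" "b = 0" using f by simp_all
    then show False using f(1) by simp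
  next
    case 2
    obtain a b c d where "2 * (c + d) \<le> a + b" "2 * a \<le> 2 + c" "1 + 2 * b \<le> (d :: nat)"
      using flow[OF mem(2)] 2 by auto
    then show False unfolding distrib_left by linarith
  next
    case 3
    obtain a b c d where "2 * (c + d) \<le> a + b" "1 + 2 * a \<le> c" "2 * b \<le> 2 + (d :: nat)"
      using flow[OF mem(1)] 3 by auto
    then show False unfolding distrib_left by linarith
  qed
qed

lemma strip_3_bound:
  assumes "solvable (strip p 3) P"
  shows "5 \<le> (\<Sum>w\<in>strip p 3. P w)"
proof (cases "even p")
  case True
  then show ?thesis using strip_3_bound_even assms by blast
next
  case False
  then have "5 \<le> (\<Sum>w\<in>strip (p + 1) 3. P (fst w, 7 - snd w))"
    by (intro strip_3_bound_even flip_strip assms) simp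
  then show ?thesis by (simp only: sum_strip_flip)
qed

section \<open>The lower bound\<close>

text \<open>At 1 and 2 these are not the optimal numbers, which are 3 and 4, but lower bounds large
  enough for subadditivity; \<open>opt 3 = opt 1 + opt 2\<close> is tight.\<close>

definition opt :: "nat \<Rightarrow> nat" where
  "opt n = (if n = 3 then 5 else if n \<in> {1, 2, 4, 8, 9} then n + 1 else n)"

lemma le_opt: "n \<le> opt n"
  by (simp add: opt_def)

lemma less_opt:
  assumes "1 \<le> n" "n \<le> 4"
  shows "n < opt n"
proof -
  have "n = 1 \<or> n = 2 \<or> n = 3 \<or> n = 4" using assms by linarith
  then show ?thesis by (elim disjE) (simp_all add: opt_def)
qed

text \<open>Lengths up to 4 exceed their length by at least 1, and in a sum equal to 8 or 9 one part
  is at most 4.\<close>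

lemma opt_add:
  assumes "1 \<le> a" "1 \<le> b"
  shows "opt (a + b) \<le> opt a + opt b"
proof -
  consider "a + b = 3" | "a + b = 2 \<or> a + b = 4 \<or> a + b = 8 \<or> a + b = 9"
    | "a + b \<notin> {1, 2, 3, 4, 8, 9}"
    using assms by force
  then show ?thesis
  proof cases
    case 1
    then have "a < opt a" "b < opt b" using assms less_opt by simp_all
    moreover have "opt (a + b) = 5" unfolding 1 by (simp add: opt_def)
    ultimately show ?thesis using 1 by linarith
  next
    case 2
    then have "a \<le> 4 \<or> b \<le> 4" by linarith
    then have "a < opt a \<or> b < opt b" using assms less_opt by blast
    moreover have "opt m = m + 1" if "m = 2 \<or> m = 4 \<or> m = 8 \<or> m = 9" for m
      using that by (elim disjE) (simp_all add: opt_def)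
    then have "opt (a + b) = a + b + 1" using 2 by blast
    ultimately show ?thesis using le_opt[of a] le_opt[of b] by linarith
  next
    case 3
    then have "opt (a + b) = a + b" by (simp add: opt_def)
    then show ?thesis using le_opt[of a] le_opt[of b] by linarith
  qed
qed

lemma sum_strip_shift:
  assumes "0 \<le> i"
  shows "(\<Sum>w\<in>strip (p + i) (n - i). P (fst w + i, snd w)) = (\<Sum>w\<in>{w\<in>strip p n. i < fst w}. P w)"
  by (rule sum.reindex_bij_witness[of _ "\<lambda>w. (fst w - i, snd w)" "\<lambda>w. (fst w + i, snd w)"])
    (use assms in \<open>auto simp: strip_iff\<close>)

lemma lower_bound:
  assumes "1 \<le> n" "solvable (strip p (int n)) P"
  shows "opt n \<le> (\<Sum>w\<in>strip p (int n). P w)"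
  using assms
proof (induction n arbitrary: p P rule: less_induct)
  case (less n)
  let ?n = "int n"
  let ?W = "strip p ?n" and ?q = "col p ?n P"
  interpret path_load ?n ?q by (rule path_load_col)
  note solv = less.prems(2)
  have split: ?case if i: "1 \<le> i" "i < ?n" and LR: "L i \<le> 1" "R (i + 1) \<le> 1" for i
  proof -
    define a where "a = nat i"
    have a: "i = int a" "1 \<le> a" "a < n" using i by (simp_all add: a_def)
    note sp = solvable_split[OF solv LR]
    have left: "{w\<in>?W. fst w \<le> i} = strip p (int a)"
      using a by (auto simp: strip_iff)
    have "opt a \<le> (\<Sum>w\<in>{w\<in>?W. fst w \<le> i}. P w)"
      using less.IH[OF a(3,2)] sp(1) unfolding left by blast
    moreover have "opt (n - a) \<le> (\<Sum>w\<in>{w\<in>?W. i < fst w}. P w)"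
    proof -
      have "solvable (strip (p + i) (int (n - a))) (\<lambda>w. P (fst w + i, snd w))"
        using shift_strip[OF sp(2)] a by (simp add: of_nat_diff)
      then have "opt (n - a) \<le> (\<Sum>w\<in>strip (p + i) (int (n - a)). P (fst w + i, snd w))"
        using a by (intro less.IH) simp_all
      also have "int (n - a) = ?n - i" using a by (simp add: of_nat_diff)
      finally show ?thesis unfolding sum_strip_shift[OF order.trans[OF zero_le_one i(1)]] .
    qed
    moreover have "(\<Sum>w\<in>?W. P w) = (\<Sum>w\<in>{w\<in>?W. fst w \<le> i}. P w) + (\<Sum>w\<in>{w\<in>?W. i < fst w}. P w)"
    proof -
      have "?W = {w\<in>?W. fst w \<le> i} \<union> {w\<in>?W. i < fst w}" by auto
      then show ?thesis
        by (subst sum.union_disjoint[symmetric]) auto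
    qed
    moreover have "opt n \<le> opt a + opt (n - a)"
      using opt_add[of a "n - a"] a by simp
    ultimately show ?thesis by linarith
  qed
  show ?case
  proof (cases "\<exists>i. 1 \<le> i \<and> i < ?n \<and> L i \<le> 1 \<and> R (i + 1) \<le> 1")
    case True
    then show ?thesis using split by blast
  next
    case False
    have bad: "i = 1 \<and> ?q 1 = 0 \<and> R 2 div 2 = 1 \<or> i = ?n \<and> ?q ?n = 0 \<and> L (?n - 1) div 2 = 1"
      if i: "1 \<le> i" "i \<le> ?n" "\<not> 2 \<le> path_reach ?n ?q i" for i
    proof -
      note b = bad_column[OF solv i]
      then consider "L (i - 1) div 2 = 1" "R (i + 1) div 2 = 0" | "L (i - 1) div 2 = 0" "R (i + 1) div 2 = 1"
        by linarith
      then show ?thesis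
      proof cases
        case 1
        then have "L i \<le> 1" "R (i + 1) \<le> 1"
          using L_rec[of i] b(1) by simp_all
        then have "\<not> i < ?n" using False i(1) by blast
        then have "i = ?n" using i(2) by simp
        then show ?thesis using 1 b by simp
      next
        case 2
        then have "L (i - 1) \<le> 1" "R i \<le> 1"
          using R_rec[of i] b(1) by simp_all
        moreover have "\<not> (1 \<le> i - 1 \<and> i - 1 < ?n \<and> L (i - 1) \<le> 1 \<and> R (i - 1 + 1) \<le> 1)"
          using False by blast
        ultimately have "i = 1" using i by auto
        then show ?thesis using 2 b by simp
      qed
    qed
    have "2 \<le> path_reach ?n ?q i" if "1 < i" "i < ?n" for i
      using bad[of i] that by linarith
    then interpret path_good ?n ?q
      by unfold_locales
    have size: "(\<Sum>w\<in>?W. P w) = (\<Sum>i\<in>{1..?n}. ?q i)"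
      by (rule sum_col[symmetric])
    consider "n = 1" | "n = 2" | "n = 3" | "4 \<le> n" using less.prems(1) by linarith
    then show ?thesis
    proof cases
      case 1
      \<comment> \<open>A deficient column is fed by a neighbour, and a single column has
        none.\<close>
      have "2 \<le> path_reach ?n ?q 1"
        using bad[of 1] 1 by fastforce
      then show ?thesis
        using no_bad_end 1 unfolding size by (simp add: opt_def)
    next
      case 2
      then show ?thesis using strip_2_bound solv by (simp add: opt_def)
    next
      case 3
      then show ?thesis using strip_3_bound solv by (simp add: opt_def)
    next
      case 4
      have left: "right_rules ?n (\<lambda>j. ?q (?n + 1 - j))" if "\<not> 2 \<le> path_reach ?n ?q 1"
        using bad[of 1] that 4 by (intro left_rules_strip[OF solv]) auto
      have right: "right_rules ?n ?q" if "\<not> 2 \<le> path_reach ?n ?q ?n"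
        using bad[of ?n] that 4 by (intro right_rules_strip[OF solv]) auto
      have opt: "opt n \<le> n + 1" "5 \<le> n \<Longrightarrow> n < 8 \<Longrightarrow> opt n \<le> n"
        using 4 by (auto simp: opt_def)
      have "n + 1 \<le> (\<Sum>i\<in>{1..?n}. ?q i) \<or> 5 \<le> n \<and> n < 8 \<and> n \<le> (\<Sum>i\<in>{1..?n}. ?q i)"
      proof (cases "2 \<le> path_reach ?n ?q 1"; cases "2 \<le> path_reach ?n ?q ?n")
        assume "2 \<le> path_reach ?n ?q 1" "2 \<le> path_reach ?n ?q ?n"
        then show ?thesis using no_bad_end 4 by simp
      next
        assume "2 \<le> path_reach ?n ?q 1" "\<not> 2 \<le> path_reach ?n ?q ?n"
        then show ?thesis using one_bad_end right 4 by simp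
      next
        assume "\<not> 2 \<le> path_reach ?n ?q 1" "2 \<le> path_reach ?n ?q ?n"
        then show ?thesis using one_bad_end_left left 4 by simp
      next
        assume "\<not> 2 \<le> path_reach ?n ?q 1" "\<not> 2 \<le> path_reach ?n ?q ?n"
        then have *: "right_rules ?n ?q" "right_rules ?n (\<lambda>j. ?q (?n + 1 - j))"
          using left right by blast+
        consider "n = 4" | "5 \<le> n" "n < 8" | "8 \<le> n" using 4 by linarith
        then show ?thesis
        proof cases
          case 1
          then show ?thesis using two_bad_ends_4[OF *] by simp
        next
          case 2
          then show ?thesis using two_bad_ends[OF *] by simp
        next
          case 3
          then show ?thesis using two_bad_ends_strict[OF *] by simp
        qed
      qed
      then show ?thesis using opt unfolding size by linarith
    qed
  qed
qed

section \<open>Solvable distributions\<close>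

definition attains :: "int \<Rightarrow> nat \<Rightarrow> nat \<Rightarrow> bool" where
  "attains p n k \<longleftrightarrow> (\<exists>P. solvable (strip p (int n)) P \<and> (\<Sum>w\<in>strip p (int n). P w) = k)"

text \<open>A list \<open>xs\<close> of positions stands for the distribution \<open>count_list xs\<close>; an illegal move discards all pebbles.\<close>

definition legal_move :: "nat \<Rightarrow> int \<times> int \<Rightarrow> int \<times> int \<Rightarrow> bool" where
  "legal_move n u v \<longleftrightarrow> (case u of (d, s) \<Rightarrow> case v of (d', s') \<Rightarrow>
    1 \<le> d \<and> d \<le> int n \<and> 1 \<le> s \<and> s \<le> 6 \<and> even (d + s) \<and>
    1 \<le> d' \<and> d' \<le> int n \<and> 1 \<le> s' \<and> s' \<le> 6 \<and> even (d' + s') \<and>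
    \<bar>d - d'\<bar> = 1 \<and> \<bar>s - s'\<bar> = 1)"

fun run :: "nat \<Rightarrow> ((int \<times> int) \<times> (int \<times> int)) list \<Rightarrow> (int \<times> int) list \<Rightarrow> (int \<times> int) list" where
  "run n [] xs = xs"
| "run n ((u, v) # ms) xs =
    (if legal_move n u v \<and> 2 \<le> count_list xs u then run n ms (v # remove1 u (remove1 u xs)) else [])"

definition solving_list :: "nat \<Rightarrow> (int \<times> int) list \<Rightarrow> ((int \<times> int) \<times> (int \<times> int)) list list \<Rightarrow> bool" where
  "solving_list n xs mss \<longleftrightarrow>
    (let vs = filter (\<lambda>(d, s). even (d + s)) (List.product [1..int n] [1..6]) in
     list_all (\<lambda>x. List.member vs x) xs \<and>
     (let ys = xs @ concat (map (\<lambda>ms. run n ms xs) mss) in list_all (\<lambda>v. List.member ys v) vs))"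

lemma legal_move_iff: "legal_move n u v \<longleftrightarrow> diag_adj (strip 0 (int n)) u v"
  by (auto simp: legal_move_def diag_adj_def strip_iff split: prod.splits)

lemma count_list_remove1: "count_list (remove1 u xs) w = count_list xs w - (if w = u then 1 else 0)"
  by (induction xs) auto

lemma run_reach:
  assumes "v \<in> set (run n ms xs)"
  shows "reach (diag_adj (strip 0 (int n))) (count_list xs) v"
  using assms
proof (induction ms arbitrary: xs)
  case Nil
  then have "1 \<le> count_list xs v"
    by (simp add: Suc_le_eq count_list_0_iff flip: neq0_conv)
  then show ?case unfolding reach_def by blast
next
  case (Cons m ms)
  obtain a b where m: "m = (a, b)" by (rule prod.exhaust)
  have c: "legal_move n a b" "2 \<le> count_list xs a"
    and v: "v \<in> set (run n ms (b # remove1 a (remove1 a xs)))"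
    using Cons.prems unfolding m by (auto split: if_splits)
  have "a \<noteq> b" using c(1) by (auto simp: legal_move_iff diag_adj_def)
  then have eq: "count_list (b # remove1 a (remove1 a xs)) =
    (count_list xs)(a := count_list xs a - 2, b := count_list xs b + 1)"
    by (auto simp: count_list_remove1 fun_eq_iff)
  have "gmove (diag_adj (strip 0 (int n))) (count_list xs) (count_list (b # remove1 a (remove1 a xs)))"
    unfolding gmove_def eq using c legal_move_iff by blast
  moreover from Cons.IH[OF v] obtain Q where
    "(gmove (diag_adj (strip 0 (int n))))\<^sup>*\<^sup>* (count_list (b # remove1 a (remove1 a xs))) Q" "1 \<le> Q v"
    unfolding reach_def by blast
  ultimately show ?case
    unfolding reach_def by (meson converse_rtranclp_into_rtranclp)
qed

lemma strip_parity: "even (p - p') \<Longrightarrow> strip p n = strip p' n"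
  by (auto simp: strip_def)

lemma attains_parity:
  assumes "attains 0 n k"
  shows "attains p n k"
proof (cases "even p")
  case True
  then have "strip p (int n) = strip 0 (int n)" by (intro strip_parity) simp
  then show ?thesis using assms by (simp add: attains_def)
next
  case False
  obtain P where P: "solvable (strip 0 (int n)) P" "(\<Sum>w\<in>strip 0 (int n). P w) = k"
    using assms unfolding attains_def by blast
  have "strip p (int n) = strip (0 + 1) (int n)"
    by (rule strip_parity) (use False in simp)
  then show ?thesis
    using flip_strip[OF P(1)] sum_strip_flip[where p = 0 and n = "int n" and P = P] P(2) unfolding attains_def by metis
qed

lemma solving_list_attains:
  assumes "solving_list n xs mss" and "length xs = k"
  shows "attains p n k"
proof -
  let ?W = "strip 0 (int n)"
  have W: "set (filter (\<lambda>(d, s). even (d + s)) (List.product [1..int n] [1..6])) = ?W"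
    by (auto simp: strip_def)
  have sub: "set xs \<subseteq> ?W"
    and all: "\<And>v. v \<in> ?W \<Longrightarrow> v \<in> set xs \<or> (\<exists>ms\<in>set mss. v \<in> set (run n ms xs))"
    using assms(1) unfolding solving_list_def Let_def list_all_iff List.member_iff W by auto
  have "solvable ?W (count_list xs)"
    unfolding solvable_def
  proof
    fix v assume "v \<in> ?W"
    \<comment> \<open>A vertex of \<open>xs\<close> is reached by the empty list of moves.\<close>
    then obtain ms where "v \<in> set (run n ms xs)"
      using all[of v] run.simps(1)[of n xs] by metis
    then show "reach (diag_adj ?W) (count_list xs) v" by (rule run_reach)
  qed
  moreover have "(\<Sum>w\<in>?W. count_list xs w) = length xs"
    using sub by (intro sum_count_set) auto
  ultimately have "attains 0 n k"
    using assms(2) unfolding attains_def by blast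
  then show ?thesis by (rule attains_parity)
qed

section \<open>Explicit distributions for short strips\<close>

lemma attains_3: "attains p 3 5"
proof -
  have "solving_list 3
    [(1, 3), (1, 5), (1, 5), (2, 2), (2, 2)]
    [[((2, 2), (1, 1)), ((1, 5), (2, 4))], [((2, 2), (3, 1)), ((1, 5), (2, 6))], [((2, 2), (3,
     3))], [((2, 2), (1, 3)), ((1, 3), (2, 4)), ((1, 5), (2, 4)), ((2, 4), (3, 5))]]"
    by code_simp
  then show ?thesis by (rule solving_list_attains) simp
qed

lemma attains_4: "attains p 4 5"
proof -
  have "solving_list 4
    [(2, 2), (2, 4), (2, 4), (2, 4), (2, 4)]
    [[((2, 4), (1, 3)), ((2, 4), (1, 5))], [((2, 4), (3, 3)), ((2, 4), (3, 5))], [((2, 4), (1,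
     5)), ((2, 4), (1, 5)), ((1, 5), (2, 6))], [((2, 4), (3, 3)), ((2, 4), (3, 3)), ((3, 3), (4,
     2))], [((2, 4), (3, 3)), ((2, 4), (3, 3)), ((3, 3), (4, 4))], [((2, 4), (3, 5)), ((2, 4),
     (3, 5)), ((3, 5), (4, 6))], [((2, 4), (1, 3)), ((2, 4), (1, 3)), ((1, 3), (2, 2)), ((2, 2),
     (1, 1))], [((2, 4), (1, 3)), ((2, 4), (1, 3)), ((1, 3), (2, 2)), ((2, 2), (3, 1))]]"
    by code_simp
  then show ?thesis by (rule solving_list_attains) simp
qed

lemma attains_5: "attains p 5 5"
proof -
  have "solving_list 5
    [(3, 3), (3, 3), (3, 3), (3, 3), (3, 5)]
    [[((3, 3), (2, 2)), ((3, 3), (2, 4))], [((3, 3), (4, 2)), ((3, 3), (4, 4))], [((3, 3), (2,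
     2)), ((3, 3), (2, 2)), ((2, 2), (1, 1))], [((3, 3), (2, 2)), ((3, 3), (2, 2)), ((2, 2), (1,
     3))], [((3, 3), (2, 2)), ((3, 3), (2, 2)), ((2, 2), (3, 1))], [((3, 3), (2, 4)), ((3, 3),
     (2, 4)), ((2, 4), (1, 5))], [((3, 3), (4, 2)), ((3, 3), (4, 2)), ((4, 2), (5, 1))], [((3,
     3), (4, 2)), ((3, 3), (4, 2)), ((4, 2), (5, 3))], [((3, 3), (4, 4)), ((3, 3), (4, 4)), ((4,
     4), (5, 5))], [((3, 3), (2, 4)), ((3, 3), (2, 4)), ((2, 4), (3, 5)), ((3, 5), (2, 6))],
     [((3, 3), (2, 4)), ((3, 3), (2, 4)), ((2, 4), (3, 5)), ((3, 5), (4, 6))]]"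
    by code_simp
  then show ?thesis by (rule solving_list_attains) simp
qed

lemma attains_6: "attains p 6 6"
proof -
  have "solving_list 6
    [(3, 3), (3, 3), (3, 3), (4, 4), (4, 4), (4, 4)]
    [[((4, 4), (3, 5)), ((3, 3), (2, 2))], [((4, 4), (5, 3)), ((3, 3), (2, 4))], [((4, 4), (5,
     5)), ((3, 3), (4, 2))], [((4, 4), (3, 3)), ((3, 3), (2, 2)), ((3, 3), (2, 2)), ((2, 2), (1,
     1))], [((4, 4), (3, 3)), ((3, 3), (2, 2)), ((3, 3), (2, 2)), ((2, 2), (1, 3))], [((4, 4),
     (3, 3)), ((3, 3), (2, 2)), ((3, 3), (2, 2)), ((2, 2), (3, 1))], [((4, 4), (3, 3)), ((3, 3),
     (2, 4)), ((3, 3), (2, 4)), ((2, 4), (1, 5))], [((4, 4), (3, 3)), ((3, 3), (4, 2)), ((3, 3),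
     (4, 2)), ((4, 2), (5, 1))], [((4, 4), (3, 5)), ((3, 3), (4, 4)), ((4, 4), (3, 5)), ((3, 5),
     (2, 6))], [((4, 4), (3, 5)), ((3, 3), (4, 4)), ((4, 4), (3, 5)), ((3, 5), (4, 6))], [((4,
     4), (5, 3)), ((3, 3), (4, 4)), ((4, 4), (5, 3)), ((5, 3), (6, 2))], [((4, 4), (5, 3)), ((3,
     3), (4, 4)), ((4, 4), (5, 3)), ((5, 3), (6, 4))], [((4, 4), (5, 5)), ((3, 3), (4, 4)), ((4,
     4), (5, 5)), ((5, 5), (6, 6))]]"
    by code_simp
  then show ?thesis by (rule solving_list_attains) simp
qed

lemma attains_7: "attains p 7 7"
proof -
  have "solving_list 7
    [(3, 3), (3, 3), (4, 2), (4, 4), (4, 4), (5, 3), (5, 3)]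
    [[((4, 4), (3, 5)), ((5, 3), (6, 2)), ((3, 3), (2, 2))], [((4, 4), (5, 5)), ((5, 3), (6,
     4)), ((3, 3), (2, 4))], [((5, 3), (4, 2)), ((4, 2), (3, 1))], [((5, 3), (4, 2)), ((4, 2),
     (5, 1))], [((4, 4), (3, 5)), ((5, 3), (4, 4)), ((3, 3), (4, 4)), ((4, 4), (3, 5)), ((3, 5),
     (2, 6))], [((4, 4), (3, 5)), ((5, 3), (4, 4)), ((3, 3), (4, 4)), ((4, 4), (3, 5)), ((3, 5),
     (4, 6))], [((4, 4), (5, 5)), ((5, 3), (4, 4)), ((3, 3), (4, 4)), ((4, 4), (5, 5)), ((5, 5),
     (6, 6))], [((4, 4), (3, 3)), ((5, 3), (4, 2)), ((3, 3), (2, 2)), ((4, 2), (3, 3)), ((3, 3),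
     (2, 2)), ((2, 2), (1, 1))], [((4, 4), (3, 3)), ((5, 3), (4, 2)), ((3, 3), (2, 2)), ((4, 2),
     (3, 3)), ((3, 3), (2, 2)), ((2, 2), (1, 3))], [((4, 4), (3, 3)), ((5, 3), (4, 2)), ((3, 3),
     (2, 4)), ((4, 2), (3, 3)), ((3, 3), (2, 4)), ((2, 4), (1, 5))], [((4, 4), (5, 3)), ((5, 3),
     (6, 2)), ((3, 3), (4, 2)), ((4, 2), (5, 3)), ((5, 3), (6, 2)), ((6, 2), (7, 1))], [((4, 4),
     (5, 3)), ((5, 3), (6, 2)), ((3, 3), (4, 2)), ((4, 2), (5, 3)), ((5, 3), (6, 2)), ((6, 2),
     (7, 3))], [((4, 4), (5, 3)), ((5, 3), (6, 4)), ((3, 3), (4, 2)), ((4, 2), (5, 3)), ((5, 3),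
     (6, 4)), ((6, 4), (7, 5))]]"
    by code_simp
  then show ?thesis by (rule solving_list_attains) simp
qed

text \<open>Gluing \<open>3 + 5\<close> or \<open>4 + 4\<close> columns costs 10 pebbles, so this
  length needs its own distribution.\<close>

lemma attains_8: "attains p 8 9"
proof -
  have "solving_list 8
    [(3, 3), (3, 3), (3, 3), (3, 3), (5, 3), (5, 3), (5, 3), (6, 4), (6, 4)]
    [[((5, 3), (4, 2)), ((3, 3), (2, 2)), ((6, 4), (5, 5)), ((3, 3), (2, 4))], [((5, 3), (6,
     2)), ((3, 3), (4, 4)), ((6, 4), (7, 3))], [((5, 3), (4, 2)), ((3, 3), (4, 2)), ((6, 4), (7,
     5)), ((4, 2), (3, 1))], [((5, 3), (4, 2)), ((3, 3), (2, 2)), ((6, 4), (5, 3)), ((5, 3), (4,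
     2)), ((3, 3), (2, 2)), ((4, 2), (5, 1)), ((2, 2), (1, 1))], [((5, 3), (4, 4)), ((3, 3), (2,
     2)), ((6, 4), (5, 3)), ((5, 3), (4, 4)), ((4, 4), (3, 5)), ((3, 3), (2, 2)), ((2, 2), (1,
     3))], [((5, 3), (6, 2)), ((3, 3), (2, 4)), ((6, 4), (5, 3)), ((5, 3), (6, 2)), ((3, 3), (2,
     4)), ((2, 4), (1, 5)), ((6, 2), (7, 1))], [((5, 3), (4, 4)), ((3, 3), (4, 4)), ((4, 4), (5,
     5)), ((6, 4), (5, 5)), ((5, 5), (4, 6))], [((5, 3), (4, 4)), ((3, 3), (4, 4)), ((4, 4), (5,
     5)), ((6, 4), (5, 5)), ((5, 5), (6, 6))], [((5, 3), (4, 4)), ((3, 3), (2, 4)), ((6, 4), (5,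
     3)), ((5, 3), (4, 4)), ((4, 4), (3, 5)), ((3, 3), (2, 4)), ((2, 4), (3, 5)), ((3, 5), (2,
     6))], [((5, 3), (6, 2)), ((3, 3), (4, 2)), ((6, 4), (7, 3)), ((3, 3), (4, 2)), ((4, 2), (5,
     3)), ((5, 3), (6, 2)), ((6, 2), (7, 3)), ((7, 3), (8, 2))], [((5, 3), (6, 2)), ((3, 3), (4,
     2)), ((6, 4), (7, 3)), ((3, 3), (4, 2)), ((4, 2), (5, 3)), ((5, 3), (6, 2)), ((6, 2), (7,
     3)), ((7, 3), (8, 4))], [((5, 3), (6, 4)), ((3, 3), (4, 2)), ((3, 3), (4, 2)), ((6, 4), (7,
     5)), ((4, 2), (5, 3)), ((5, 3), (6, 4)), ((6, 4), (7, 5)), ((7, 5), (8, 6))]]"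
    by code_simp
  then show ?thesis by (rule solving_list_attains) simp
qed

section \<open>Gluing blocks\<close>

text \<open>The right block starts after \<open>a\<close> columns and thus has parity
  \<open>p + a\<close>, hence the hypotheses for all \<open>p\<close>. The arcs between the blocks
  only add moves.\<close>

lemma attains_add:
  assumes "\<And>p. attains p a k" "\<And>p. attains p b l"
  shows "attains p (a + b) (k + l)"
proof -
  obtain P where P: "solvable (strip p (int a)) P" "(\<Sum>w\<in>strip p (int a). P w) = k"
    using assms(1) unfolding attains_def by blast
  obtain P' where P': "solvable (strip (p + int a) (int b)) P'" "(\<Sum>w\<in>strip (p + int a) (int b). P' w) = l"
    using assms(2) unfolding attains_def by blast
  let ?W = "strip p (int (a + b))"
  let ?A = "{w\<in>?W. fst w \<le> int a}" and ?B = "{w\<in>?W. int a < fst w}"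
  define Q where "Q w = (if fst w \<le> int a then P w else P' (fst w - int a, snd w))" for w
  have A: "strip p (int a) = ?A" by (auto simp: strip_iff)
  have "solvable ?A Q"
    by (rule solvable_map[where h = id and h' = id, OF _ _ _ _ P(1)])
      (auto simp: A Q_def)
  moreover have "solvable ?B Q"
    by (rule solvable_map[where h = "\<lambda>w. (fst w + int a, snd w)" and h' = "\<lambda>w. (fst w - int a, snd w)",
          OF _ _ _ _ P'(1)]) (auto simp: strip_iff Q_def)
  moreover have mono: "reach (diag_adj ?W) Q v" if "reach (diag_adj V) Q v" "V \<subseteq> ?W" "v \<in> V" for V v
    using reach_map[where h = id and S = V and A = "diag_adj V" and A' = "diag_adj ?W", OF _ _ _ that(3,1)] that(2)
    by (auto simp: diag_adj_def)
  ultimately have "solvable ?W Q"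
    unfolding solvable_def by (metis (no_types, lifting) mem_Collect_eq not_le subsetI)
  moreover have "(\<Sum>w\<in>?W. Q w) = k + l"
  proof -
    have "(\<Sum>w\<in>?B. Q w) = l"
      unfolding P'(2)[symmetric]
      by (rule sum.reindex_bij_witness[of _ "\<lambda>w. (fst w + int a, snd w)" "\<lambda>w. (fst w - int a, snd w)"])
        (auto simp: strip_iff Q_def)
    moreover have "(\<Sum>w\<in>?A. Q w) = k"
      unfolding P(2)[symmetric] A by (rule sum.cong) (auto simp: Q_def)
    moreover have "?W = ?A \<union> ?B" by auto
    then have "(\<Sum>w\<in>?W. Q w) = (\<Sum>w\<in>?A. Q w) + (\<Sum>w\<in>?B. Q w)"
      by (subst sum.union_disjoint[symmetric]) auto
    ultimately show ?thesis by simp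
  qed
  ultimately show ?thesis unfolding attains_def by blast
qed

lemma attains_self:
  assumes "5 \<le> n" "n \<noteq> 8" "n \<noteq> 9"
  shows "attains p n n"
  using assms
proof (induction n arbitrary: p rule: less_induct)
  case (less n)
  \<comment> \<open>For 13 and 14, taking off a block of 5 would leave 8 or 9.\<close>
  consider "n = 5" | "n = 6" | "n = 7" | "n = 13" | "n = 14" | "10 \<le> n" "n \<noteq> 13" "n \<noteq> 14"
    using less.prems by linarith
  then show ?case
  proof cases
    case 4
    then show ?thesis using attains_add[OF attains_6 attains_7] by simp
  next
    case 5
    then show ?thesis using attains_add[OF attains_7 attains_7] by simp
  next
    case 6
    then have "attains p (n - 5) (n - 5)" for p
      by (intro less.IH) auto
    then show ?thesis using attains_add[OF attains_5, of "n - 5" "n - 5" p] 6 by simp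
  qed (simp_all add: attains_5 attains_6 attains_7)
qed

lemma attains_opt:
  assumes "3 \<le> n"
  shows "attains p n (opt n)"
proof -
  consider "n = 3" | "n = 4" | "n = 8" | "n = 9" | "5 \<le> n" "n \<noteq> 8" "n \<noteq> 9"
    using assms by linarith
  then show ?thesis
  proof cases
    case 1
    then show ?thesis using attains_3 by (simp add: opt_def)
  next
    case 2
    then show ?thesis using attains_4 by (simp add: opt_def)
  next
    case 3
    then show ?thesis using attains_8 by (simp add: opt_def)
  next
    case 4
    then show ?thesis using attains_add[OF attains_4 attains_5] by (simp add: opt_def)
  next
    case 5
    then show ?thesis using attains_self by (simp add: opt_def)
  qed
qed

section \<open>The grid in diagonal coordinates\<close>

definition diag :: "int \<times> int \<Rightarrow> int \<times> int" where
  "diag v = (fst v - snd v, fst v + snd v)"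

text \<open>The divisions are exact on \<open>strip 0 n\<close>, where both coordinates have the
  same parity.\<close>

definition undiag :: "int \<times> int \<Rightarrow> int \<times> int" where
  "undiag w = ((fst w + snd w) div 2, (snd w - fst w) div 2)"

lemma undiag_diag [simp]: "undiag (diag v) = v"
  by (cases v) (simp add: diag_def undiag_def)

lemma diag_undiag:
  assumes "w \<in> strip 0 n"
  shows "diag (undiag w) = w"
proof -
  obtain k where "fst w + snd w = 2 * k"
    using assms unfolding strip_iff by (metis add.right_neutral evenE)
  then have k: "snd w = 2 * k - fst w" by simp
  have "(2 * k - fst w - fst w) div 2 = k - fst w"
  proof -
    have "2 * k - fst w - fst w = 2 * (k - fst w)" by simp
    then show ?thesis by simp
  qed
  then show ?thesis
    by (simp add: diag_def undiag_def k prod_eq_iff)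
qed

lemma diag_strip: "diag v \<in> strip 0 (int n) \<longleftrightarrow> v \<in> verts (diagonal_grid 6 n)"
  by (cases v) (auto simp: diag_def strip_def diagonal_grid_def square_grid_def pos_diagonal_def neg_diagonal_def)

lemma dominates_iff:
  "u \<rightarrow>\<^bsub>diagonal_grid 6 n\<^esub> v \<longleftrightarrow> diag_adj (strip 0 (int n)) (diag u) (diag v)"
proof -
  have "u \<rightarrow>\<^bsub>diagonal_grid 6 n\<^esub> v \<longleftrightarrow> u \<in> verts (diagonal_grid 6 n) \<and> v \<in> verts (diagonal_grid 6 n) \<and>
    \<bar>fst u - fst v\<bar> + \<bar>snd u - snd v\<bar> = 1"
    by (auto simp: diagonal_grid_def square_grid_def arcs_ends_conv)
  also have "\<bar>fst u - fst v\<bar> + \<bar>snd u - snd v\<bar> = 1 \<longleftrightarrow>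
    \<bar>fst (diag u) - fst (diag v)\<bar> = 1 \<and> \<bar>snd (diag u) - snd (diag v)\<bar> = 1"
    unfolding diag_def by (simp, arith)
  finally show ?thesis unfolding diag_adj_def diag_strip .
qed

lemma pebbling_reachable_iff: "pebbling_reachable G P v \<longleftrightarrow> reach (\<lambda>u v. u \<rightarrow>\<^bsub>G\<^esub> v) P v"
proof -
  have "pebbling_move G = gmove (\<lambda>u v. u \<rightarrow>\<^bsub>G\<^esub> v)"
    by (intro ext) (simp add: pebbling_move_def gmove_def)
  then show ?thesis by (simp add: pebbling_reachable_def reach_def)
qed

lemma optimal_pebbling_number_diagonal_grid:
  assumes "3 \<le> n"
  shows "optimal_pebbling_number (diagonal_grid 6 n) = opt n"
  unfolding optimal_pebbling_number_def
proof (rule Least_equality)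
  let ?G = "diagonal_grid 6 n" and ?W = "strip 0 (int n)"
  obtain P where P: "solvable ?W P" "(\<Sum>w\<in>?W. P w) = opt n"
    using attains_opt[OF assms] unfolding attains_def by blast
  define Q where "Q v = (if v \<in> verts ?G then P (diag v) else 0)" for v
  have "pebbling_solvable ?G Q"
    unfolding pebbling_solvable_def pebbling_reachable_iff
  proof
    fix v assume v: "v \<in> verts ?G"
    then have "diag v \<in> ?W" by (simp add: diag_strip)
    then have r: "reach (diag_adj ?W) P (diag v)" using P(1) unfolding solvable_def by blast
    have "reach (\<lambda>u v. u \<rightarrow>\<^bsub>?G\<^esub> v) Q (undiag (diag v))"
    proof (rule reach_map[where S = ?W, OF _ _ _ _ r])
      show "inj_on undiag ?W" by (rule inj_on_inverseI) (rule diag_undiag)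
      show "u \<in> ?W \<and> w \<in> ?W \<and> undiag u \<rightarrow>\<^bsub>?G\<^esub> undiag w" if "diag_adj ?W u w" for u w
      proof -
        have "u \<in> ?W" "w \<in> ?W" using that by (simp_all add: diag_adj_def)
        then show ?thesis using that by (simp add: dominates_iff diag_undiag)
      qed
      show "Q (undiag w) = P w" if "w \<in> ?W" for w
        using that diag_strip[of "undiag w" n] by (simp add: Q_def diag_undiag)
    qed fact
    then show "reach (\<lambda>u v. u \<rightarrow>\<^bsub>?G\<^esub> v) Q v" by simp
  qed
  moreover have "pebbling_distribution ?G Q"
    by (simp add: pebbling_distribution_def Q_def)
  moreover have "pebbling_size ?G Q = opt n"
    unfolding pebbling_size_def P(2)[symmetric]
    by (rule sum.reindex_bij_witness[of _ undiag diag])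
      (simp_all add: diag_strip diag_undiag Q_def flip: diag_strip)
  ultimately show "\<exists>P. pebbling_distribution ?G P \<and> pebbling_solvable ?G P \<and> pebbling_size ?G P = opt n"
    by blast
next
  let ?G = "diagonal_grid 6 n" and ?W = "strip 0 (int n)"
  fix k
  assume "\<exists>P. pebbling_distribution ?G P \<and> pebbling_solvable ?G P \<and> pebbling_size ?G P = k"
  then obtain P where P: "pebbling_solvable ?G P" "pebbling_size ?G P = k" by blast
  have "solvable ?W (\<lambda>w. P (undiag w))"
    unfolding solvable_def
  proof
    fix w assume w: "w \<in> ?W"
    then have v: "undiag w \<in> verts ?G"
      by (simp add: diag_undiag flip: diag_strip)
    then have r: "reach (\<lambda>u v. u \<rightarrow>\<^bsub>?G\<^esub> v) P (undiag w)"
      using P(1) unfolding pebbling_solvable_def pebbling_reachable_iff by blast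
    have "reach (diag_adj ?W) (\<lambda>w. P (undiag w)) (diag (undiag w))"
    proof (rule reach_map[where S = "verts ?G", OF _ _ _ v r])
      show "inj_on diag (verts ?G)" by (rule inj_on_inverseI) (rule undiag_diag)
      show "u \<in> verts ?G \<and> v \<in> verts ?G \<and> diag_adj ?W (diag u) (diag v)" if "u \<rightarrow>\<^bsub>?G\<^esub> v" for u v
        using that unfolding dominates_iff by (simp add: diag_adj_def diag_strip)
    qed simp
    then show "reach (diag_adj ?W) (\<lambda>w. P (undiag w)) w" using w by (simp add: diag_undiag)
  qed
  then have "opt n \<le> (\<Sum>w\<in>?W. P (undiag w))"
    using assms by (intro lower_bound) simp_all
  also have "\<dots> = (\<Sum>v\<in>verts ?G. P v)"
    by (rule sum.reindex_bij_witness[of _ diag undiag])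
      (simp_all add: diag_undiag flip: diag_strip)
  finally show "opt n \<le> k" using P(2) by (simp add: pebbling_size_def)
qed

theorem theorem2p11:
  shows "(\<forall>n::nat. n \<ge> 1 \<and> n \<notin> {1, 2, 3, 4, 8, 9} \<longrightarrow>
            optimal_pebbling_number (diagonal_grid 6 n) = n) \<and>
         optimal_pebbling_number (diagonal_grid 6 3) = 5 \<and>
         optimal_pebbling_number (diagonal_grid 6 4) = 5 \<and>
         optimal_pebbling_number (diagonal_grid 6 8) = 9 \<and>
         optimal_pebbling_number (diagonal_grid 6 9) = 10"
  by (auto simp: optimal_pebbling_number_diagonal_grid opt_def)

end
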